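(* Let $Y$ be a real Banach space and let $X$ be a subspace of $Y$. Then $X$ is an almost isometric u-ideal in $Y$ if and only if $X$ is a strict u-ideal in $Y$.
   Context: All Banach spaces are real and non-zero. Let $X$ be a subspace of a Banach space $Y$, and let $X^{\perp}\subset Y^{*}$ be its annihilator. An ideal projection for $X$ is a linear projection $P$ on $Y^{*}$ with $\|P\|\le 1$ and $\ker P=X^{\perp}$. $X$ is a u-ideal in $Y$ if there is an ideal projection $P:Y^{*}\to Y^{*}$ with $\|I-2P\|=1$. If, for such a $P$ (with $\|I-2P\|=1$), the range of $P$ is 1-norming for $Y$, i.e. $\|y\|=\sup\{|y^{*}(y)| : y^{*}\in P(Y^{*}),\ \|y^{*}\|\le 1\}$ for all $y\in Y$, then $X$ is called a strict u-ideal in $Y$. (There is at most one ideal projection $P$ with $\|I-2P\|=1$.) $X$ is an almost isometric u-ideal (ai-u-ideal) in $Y$ if for every $\varepsilon>0$ and every finite-dimensional subspace $E\subset Y$ there exists a linear operator $T:E\to X$ such that (1) $Te=e$ for all $e\in X\cap E$; (2) $(1+\varepsilon)^{-1}\|e\|\le\|Te\|\le(1+\varepsilon)\|e\|$ for all $e\in E$; (3) $\|e-2Te\|\le(1+\varepsilon)\|e\|$ for all $e\in E$. *)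

theory Defs
  imports "HOL-Analysis.Analysis"
begin

text \<open>The dual of a real normed space \<open>'a\<close> is the type \<open>'a \<Rightarrow>\<^sub>L real\<close> of bounded linear
  functionals, whose norm is the operator norm. Subspaces are not required to be closed.\<close>

definition annihilator :: "'a::real_normed_vector set \<Rightarrow> ('a \<Rightarrow>\<^sub>L real) set" where
  "annihilator X = {f. \<forall>x\<in>X. blinfun_apply f x = 0}"

definition ideal_projection ::
  "'a::real_normed_vector set \<Rightarrow> (('a \<Rightarrow>\<^sub>L real) \<Rightarrow>\<^sub>L ('a \<Rightarrow>\<^sub>L real)) \<Rightarrow> bool" where
  "ideal_projection X P \<longleftrightarrow>
     P o\<^sub>L P = P \<and> norm P \<le> 1 \<and> {f. blinfun_apply P f = 0} = annihilator X"

text \<open>The supremum below is over a set that contains \<open>0\<close> and is bounded by \<open>norm y\<close>, so the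
  conditionally complete \<open>Sup\<close> on the reals is the genuine supremum.\<close>

definition one_norming :: "('a::real_normed_vector \<Rightarrow>\<^sub>L real) set \<Rightarrow> bool" where
  "one_norming V \<longleftrightarrow>
     (\<forall>y. norm y = Sup {\<bar>blinfun_apply f y\<bar> | f. f \<in> V \<and> norm f \<le> 1})"

definition strict_u_ideal :: "'a::real_normed_vector set \<Rightarrow> bool" where
  "strict_u_ideal X \<longleftrightarrow>
     (\<exists>P. ideal_projection X P \<and> norm (id_blinfun - 2 *\<^sub>R P) = 1 \<and>
          one_norming (range (blinfun_apply P)))"

definition finite_dim_subspace :: "'a::real_vector set \<Rightarrow> bool" where
  "finite_dim_subspace E \<longleftrightarrow> subspace E \<and> (\<exists>B. finite B \<and> E = span B)"

text \<open>A linear operator \<open>E \<rightarrow> X\<close> is a function on the whole type of which only the values on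
  \<open>E\<close> are constrained.\<close>

definition linear_operator_between ::
  "'a::real_vector set \<Rightarrow> 'b::real_vector set \<Rightarrow> ('a \<Rightarrow> 'b) \<Rightarrow> bool" where
  "linear_operator_between E X T \<longleftrightarrow>
     T ` E \<subseteq> X \<and>
     (\<forall>x\<in>E. \<forall>y\<in>E. T (x + y) = T x + T y) \<and>
     (\<forall>c. \<forall>x\<in>E. T (c *\<^sub>R x) = c *\<^sub>R T x)"

definition ai_u_ideal :: "'a::real_normed_vector set \<Rightarrow> bool" where
  "ai_u_ideal X \<longleftrightarrow>
     (\<forall>\<epsilon>>0. \<forall>E. finite_dim_subspace E \<longrightarrow>
        (\<exists>T. linear_operator_between E X T \<and>
             (\<forall>e\<in>X \<inter> E. T e = e) \<and>
             (\<forall>e\<in>E. inverse (1 + \<epsilon>) * norm e \<le> norm (T e) \<and>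
                     norm (T e) \<le> (1 + \<epsilon>) * norm e) \<and>
             (\<forall>e\<in>E. norm (e - 2 *\<^sub>R T e) \<le> (1 + \<epsilon>) * norm e)))"

end

theory Submission
  imports Defs "HOL-Analysis.Finite_Function_Topology"
begin

text \<open>
  Write \<open>Y\<close> for the whole space and \<open>P f y\<close> for the value of \<open>P f\<close> at \<open>y\<close>. An ideal projection
  is dual to a contraction \<open>\<Phi>\<close> of \<open>Y\<close> into the bidual of \<open>X\<close> that fixes \<open>X\<close>; strictness says that
  \<open>\<Phi>\<close> is isometric, and \<open>norm (id_blinfun - 2 *\<^sub>R P) = 1\<close> is a contractivity condition on \<open>1 - 2\<Phi>\<close>.
  The local operators \<open>T\<close> of an almost isometric u-ideal are finite-dimensional approximations of
  \<open>\<Phi>\<close> with values in \<open>X\<close>, so the equivalence is a form of the principle of local reflexivity.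

  From operators to a projection: a cluster point of the bilinear forms \<open>(f, e) \<mapsto> f (T e)\<close>, which
  exists by Tychonoff's theorem, is the form \<open>(f, y) \<mapsto> P f y\<close>
  (\<open>u_projection_of_ai_u_ideal\<close>). A limit of near-isometries need not be isometric, since norms
  may drop in a weak limit, so that the range of \<open>P\<close> is norming needs an argument. Fix one operator
  \<open>T\<close> at \<open>y\<close> and put \<open>x = T y\<close>. Then \<open>x\<close> lies in \<open>X\<close>, where \<open>P f\<close> and \<open>f\<close> agree. For \<open>f\<close> of norm at
  most 1 norming \<open>x\<close>,
  \<open>P f y = 2 * f x - P f (2 x - y) \<ge> 2 * norm x - norm (y - 2 x)\<close>,
  and this is nearly \<open>2 * norm y - norm y\<close>, because \<open>norm x\<close> is almost \<open>norm y\<close> and \<open>norm (y - 2 x)\<close>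
  exceeds \<open>norm y\<close> hardly (\<open>range_of_u_projection_norming\<close>).

  From a projection to operators: on a finite net of the unit ball of \<open>E\<close> the wanted bounds on
  \<open>T\<close> are finitely many norm inequalities for affine functions of finitely many unknown vectors of
  \<open>X\<close>; the lower bound on \<open>norm (T e)\<close> is imposed through a functional in the range of \<open>P\<close> that
  almost norms \<open>e\<close>. By the Hahn-Banach theorem such a system is solvable up to \<open>\<epsilon>\<close> unless it
  contradicts a linear combination of itself (\<open>Helly_condition\<close>). A functional that does not see the
  unknowns has coefficients in the annihilator of \<open>X\<close>, the kernel of \<open>P\<close>, and so cannot distinguish
  \<open>T\<close> from \<open>\<Phi>\<close>; for \<open>\<Phi>\<close> all the inequalities hold (\<open>ideal_projection_lifting\<close>). Passing from the
  net to all of \<open>E\<close> is a perturbation argument resting on the compactness of balls in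
  finite-dimensional subspaces (\<open>almost_isometry_from_net\<close>).
\<close>

section \<open>Sublinear functionals and the Hahn-Banach theorem\<close>

definition sublinear :: "('a::real_vector \<Rightarrow> real) \<Rightarrow> bool" where
  "sublinear p \<longleftrightarrow>
     (\<forall>x y. p (x + y) \<le> p x + p y) \<and> (\<forall>c x. 0 \<le> c \<longrightarrow> p (c *\<^sub>R x) = c * p x)"

lemma sublinear_add: "sublinear p \<Longrightarrow> p (x + y) \<le> p x + p y"
  and sublinear_scaleR: "sublinear p \<Longrightarrow> 0 \<le> c \<Longrightarrow> p (c *\<^sub>R x) = c * p x"
  by (auto simp: sublinear_def)

lemma sublinear_zero: "sublinear p \<Longrightarrow> p 0 = 0"
  using sublinear_scaleR[of p 0 0] by simp

lemma sublinear_minus: "sublinear p \<Longrightarrow> - p (- x) \<le> p x"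
  using sublinear_add[of p x "- x"] sublinear_zero[of p] by simp

text \<open>Positive homogeneity is an inequality in disguise: applied to \<open>inverse c\<close>, the estimate
  for \<open>c\<close> yields the reverse one.\<close>

lemma sublinearI:
  assumes add: "\<And>x y. p (x + y) \<le> p x + p y"
    and zero: "p 0 = 0"
    and scale: "\<And>c x. 0 < c \<Longrightarrow> p (c *\<^sub>R x) \<le> c * p x"
  shows "sublinear p"
  unfolding sublinear_def
proof (intro conjI allI impI add)
  fix c :: real and x
  assume "0 \<le> c"
  show "p (c *\<^sub>R x) = c * p x"
  proof (cases "c = 0")
    case False
    with \<open>0 \<le> c\<close> have c: "0 < c" by simp
    have "p x \<le> inverse c * p (c *\<^sub>R x)"
      using scale[of "inverse c" "c *\<^sub>R x"] c by simp
    then have "c * p x \<le> p (c *\<^sub>R x)"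
      using c by (simp add: field_simps)
    with scale[OF c] show ?thesis by (metis order_antisym)
  qed (simp add: zero)
qed

text \<open>The infimum is finite because \<open>- p (- x)\<close> bounds every sublinear \<open>q \<le> p\<close> from below.
  Subadditivity is where the chain matters: the smaller of two members bounds both summands.\<close>

lemma sublinear_INF_chain:
  assumes "C \<noteq> {}" and sub: "\<And>q. q \<in> C \<Longrightarrow> sublinear q"
    and below: "\<And>q x. q \<in> C \<Longrightarrow> q x \<le> p x"
    and chain: "\<And>q r. q \<in> C \<Longrightarrow> r \<in> C \<Longrightarrow> (\<forall>x. q x \<le> r x) \<or> (\<forall>x. r x \<le> q x)"
  shows "sublinear (\<lambda>x. INF q\<in>C. q x)" and "\<And>q x. q \<in> C \<Longrightarrow> (INF q\<in>C. q x) \<le> q x"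
proof -
  have "bdd_below ((\<lambda>q. q x) ` C)" for x
  proof (rule bdd_belowI2)
    fix q assume "q \<in> C"
    then show "- p (- x) \<le> q x"
      using sublinear_minus[OF sub, of q x] below[of q "- x"] by linarith
  qed
  then show le: "(INF q\<in>C. q x) \<le> q x" if "q \<in> C" for q x
    using that by (intro cINF_lower)
  show "sublinear (\<lambda>x. INF q\<in>C. q x)"
  proof (rule sublinearI)
    fix x y
    have sum_le: "(INF q\<in>C. q (x + y)) \<le> q x + r y" if qr: "q \<in> C" "r \<in> C" for q r
    proof -
      obtain s where s: "s \<in> C" "s x \<le> q x" "s y \<le> r y"
        using chain[OF qr] qr by (metis order_refl)
      then show ?thesis
        using le[OF s(1), of "x + y"] sublinear_add[OF sub, OF s(1), of x y] by linarith
    qed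
    have "(INF q\<in>C. q (x + y)) - q x \<le> (INF r\<in>C. r y)" if "q \<in> C" for q
      using sum_le[OF that] by (intro cINF_greatest \<open>C \<noteq> {}\<close>) (simp add: diff_le_eq add.commute)
    then have "(INF q\<in>C. q (x + y)) - (INF r\<in>C. r y) \<le> (INF q\<in>C. q x)"
      by (intro cINF_greatest \<open>C \<noteq> {}\<close>) (simp add: diff_le_eq add.commute)
    then show "(INF q\<in>C. q (x + y)) \<le> (INF q\<in>C. q x) + (INF q\<in>C. q y)"
      by simp
  next
    have "(\<lambda>q. q 0) ` C = {0}"
      using \<open>C \<noteq> {}\<close> by (auto simp: sublinear_zero[OF sub] image_iff)
    then show "(INF q\<in>C. q 0) = 0" by simp
  next
    fix c :: real and x assume c: "0 < c"
    have "(INF q\<in>C. q (c *\<^sub>R x)) / c \<le> (INF q\<in>C. q x)"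
    proof (intro cINF_greatest \<open>C \<noteq> {}\<close>)
      fix q assume q: "q \<in> C"
      have "(INF q\<in>C. q (c *\<^sub>R x)) \<le> c * q x"
        using le[OF q, of "c *\<^sub>R x"] sublinear_scaleR[OF sub[OF q], of c x] c by simp
      then show "(INF q\<in>C. q (c *\<^sub>R x)) / c \<le> q x"
        using c by (simp add: field_simps)
    qed
    then show "(INF q\<in>C. q (c *\<^sub>R x)) \<le> c * (INF q\<in>C. q x)"
      using c by (simp add: field_simps)
  qed
qed

text \<open>The largest sublinear functional below \<open>q\<close> whose value at \<open>- a\<close> is at most \<open>- q a\<close>.
  A sublinear functional that no tilting decreases is additive.\<close>

definition tilt :: "('a::real_vector \<Rightarrow> real) \<Rightarrow> 'a \<Rightarrow> 'a \<Rightarrow> real" where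
  "tilt q a x = (INF t\<in>{0..}. q (x + t *\<^sub>R a) - t * q a)"

lemma tilt_le:
  assumes q: "sublinear q" and "0 \<le> t"
  shows "tilt q a x \<le> q (x + t *\<^sub>R a) - t * q a"
proof -
  have "bdd_below ((\<lambda>t. q (x + t *\<^sub>R a) - t * q a) ` {0..})"
  proof (rule bdd_belowI2)
    fix t :: real assume "t \<in> {0..}"
    then have "t * q a = q ((x + t *\<^sub>R a) + - x)"
      using sublinear_scaleR[OF q, of t a] by simp
    also have "\<dots> \<le> q (x + t *\<^sub>R a) + q (- x)"
      by (rule sublinear_add[OF q])
    finally show "- q (- x) \<le> q (x + t *\<^sub>R a) - t * q a" by simp
  qed
  then show ?thesis
    unfolding tilt_def using \<open>0 \<le> t\<close> by (intro cINF_lower) auto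
qed

lemma sublinear_tilt:
  assumes q: "sublinear q"
  shows "sublinear (tilt q a)"
proof (rule sublinearI)
  fix x y
  let ?v = "\<lambda>x t. q (x + t *\<^sub>R a) - t * q a"
  have "tilt q a (x + y) \<le> ?v x t + ?v y u" if "0 \<le> t" "0 \<le> u" for t u
  proof -
    have "tilt q a (x + y) \<le> ?v (x + y) (t + u)"
      using that by (intro tilt_le q) simp
    moreover have "q (x + y + (t + u) *\<^sub>R a) \<le> q (x + t *\<^sub>R a) + q (y + u *\<^sub>R a)"
      using sublinear_add[OF q, of "x + t *\<^sub>R a" "y + u *\<^sub>R a"] by (simp add: algebra_simps)
    ultimately show ?thesis by (simp add: algebra_simps)
  qed
  then have "tilt q a (x + y) - ?v x t \<le> tilt q a y" if "0 \<le> t" for t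
    unfolding tilt_def[of q a y]
  proof (intro cINF_greatest)
    fix u :: real assume "u \<in> {0..}"
    then show "tilt q a (x + y) - ?v x t \<le> ?v y u"
      using \<open>\<And>u t. 0 \<le> t \<Longrightarrow> 0 \<le> u \<Longrightarrow> tilt q a (x + y) \<le> ?v x t + ?v y u\<close>[of t u] that by simp
  qed simp
  then have "tilt q a (x + y) - tilt q a y \<le> tilt q a x"
    unfolding tilt_def[of q a x]
    by (intro cINF_greatest) (auto simp: algebra_simps)
  then show "tilt q a (x + y) \<le> tilt q a x + tilt q a y" by simp
next
  show "tilt q a 0 = 0"
    unfolding tilt_def by (simp add: sublinear_scaleR[OF q] cong: INF_cong_simp)
next
  fix c :: real and x assume c: "0 < c"
  have "tilt q a (c *\<^sub>R x) / c \<le> tilt q a x"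
    unfolding tilt_def[of q a x]
  proof (intro cINF_greatest)
    fix t :: real assume t: "t \<in> {0..}"
    have "tilt q a (c *\<^sub>R x) \<le> q (c *\<^sub>R x + (c * t) *\<^sub>R a) - (c * t) * q a"
      using c t by (intro tilt_le q) auto
    also have "c *\<^sub>R x + (c * t) *\<^sub>R a = c *\<^sub>R (x + t *\<^sub>R a)"
      by (simp add: algebra_simps)
    finally show "tilt q a (c *\<^sub>R x) / c \<le> q (x + t *\<^sub>R a) - t * q a"
      using c sublinear_scaleR[OF q, of c "x + t *\<^sub>R a"] by (simp add: field_simps)
  qed auto
  then show "tilt q a (c *\<^sub>R x) \<le> c * tilt q a x"
    using c by (simp add: field_simps)
qed

text \<open>Zorn's lemma for the pointwise order on total functions. Compared with the usual extension of
  partially defined linear functionals, domains do not have to be tracked: linearity comes out of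
  minimality.\<close>

lemma minimal_sublinear_exists:
  assumes p: "sublinear p"
  obtains q where "sublinear q" "\<And>x. q x \<le> p x"
    "\<And>r. sublinear r \<Longrightarrow> (\<And>x. r x \<le> q x) \<Longrightarrow> r = q"
proof -
  let ?A = "{q. sublinear q \<and> (\<forall>x. q x \<le> p x)}" and ?R = "\<lambda>q r. \<forall>x. r x \<le> q x"
  have "\<exists>m\<in>?A. \<forall>q\<in>?A. ?R m q \<longrightarrow> q = m"
  proof (rule predicate_Zorn)
    show "partial_order_on ?A (relation_of ?R ?A)"
      by (rule partial_order_on_relation_ofI) (auto intro: order_trans simp: fun_eq_iff order_antisym)
  next
    fix C assume C: "C \<in> Chains (relation_of ?R ?A)"
    then have A: "C \<subseteq> ?A"
      by (auto simp: Chains_def relation_of_def)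
    have chain: "(\<forall>x. q x \<le> r x) \<or> (\<forall>x. r x \<le> q x)" if "q \<in> C" "r \<in> C" for q r
      using C that by (auto simp: Chains_def relation_of_def)
    show "\<exists>u\<in>?A. \<forall>q\<in>C. ?R q u"
    proof (cases "C = {}")
      case True
      then show ?thesis using p by auto
    next
      case False
      note m = sublinear_INF_chain[OF False, of p]
      have "sublinear (\<lambda>x. INF q\<in>C. q x)" and le: "\<And>q x. q \<in> C \<Longrightarrow> (INF q\<in>C. q x) \<le> q x"
        using m A chain by blast+
      moreover have "(INF q\<in>C. q x) \<le> p x" for x
        using False le A by (metis (mono_tags, lifting) all_not_in_conv mem_Collect_eq order_trans subsetD)
      ultimately show ?thesis
        by (intro bexI[where x="\<lambda>x. INF q\<in>C. q x"] CollectI conjI allI ballI)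
    qed
  qed
  then obtain q where q: "q \<in> ?A" "\<forall>r\<in>?A. ?R q r \<longrightarrow> r = q" by (rule bexE)
  show ?thesis
  proof (rule that[of q])
    fix r assume r: "sublinear r" "\<And>x. r x \<le> q x"
    then have "r x \<le> p x" for x
      using q(1) order_trans[of "r x" "q x" "p x"] by simp
    with r q(2) show "r = q" by simp
  qed (use q(1) in simp_all)
qed

text \<open>A minimal sublinear \<open>q\<close> equals all of its tilts, and \<open>q x \<le> q (x + b) - q b\<close>, the tilt
  by \<open>b\<close> at parameter 1, is the missing half of additivity. Starting from the tilt of \<open>p\<close> by \<open>a\<close>
  rather than from \<open>p\<close> itself forces the value \<open>p a\<close> at \<open>a\<close>.\<close>

theorem Hahn_Banach:
  fixes p :: "'a::real_vector \<Rightarrow> real"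
  assumes p: "sublinear p"
  obtains f where "linear f" "\<And>x. f x \<le> p x" "f a = p a"
proof -
  obtain q where q: "sublinear q" and le: "\<And>x. q x \<le> tilt p a x"
    and min: "\<And>r. sublinear r \<Longrightarrow> (\<And>x. r x \<le> q x) \<Longrightarrow> r = q"
    using minimal_sublinear_exists[OF sublinear_tilt[OF p, of a]] by metis
  have tilt: "tilt q b = q" for b
    using tilt_le[OF q, of 0 b] by (intro min sublinear_tilt[OF q]) simp
  have add: "q (x + b) = q x + q b" for x b
  proof (rule antisym)
    show "q x + q b \<le> q (x + b)"
      using tilt_le[OF q, of 1 b x] by (simp add: tilt)
  qed (rule sublinear_add[OF q])
  have neg: "q (- x) = - q x" for x
    using add[of x "- x"] sublinear_zero[OF q] by simp
  have "linear q"
  proof (rule linearI)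
    fix c x
    show "q (c *\<^sub>R x) = c *\<^sub>R q x"
    proof (cases "0 \<le> c")
      case False
      then have "q (c *\<^sub>R x) = - ((- c) * q x)"
        using sublinear_scaleR[OF q, of "- c" x] neg[of "(- c) *\<^sub>R x"] by simp
      then show ?thesis by simp
    qed (simp add: sublinear_scaleR[OF q])
  qed (rule add)
  moreover have "q x \<le> p x" for x
    using le[of x] tilt_le[OF p, of 0 a x] by simp
  moreover have "q a = p a"
    using le[of "- a"] tilt_le[OF p, of 1 a "- a"] neg[of a] sublinear_zero[OF p]
      calculation(2)[of a] by simp
  ultimately show ?thesis by (rule that)
qed

lemma norming_functional:
  fixes x :: "'a::real_normed_vector"
  obtains f :: "'a \<Rightarrow>\<^sub>L real" where "norm f \<le> 1" "blinfun_apply f x = norm x"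
proof -
  have "sublinear (norm :: 'a \<Rightarrow> real)"
    by (auto simp: sublinear_def norm_triangle_ineq)
  then obtain g where g: "linear g" "\<And>y. g y \<le> norm y" "g x = norm (x :: 'a)"
    using Hahn_Banach by blast
  have b: "\<bar>g y\<bar> \<le> norm y" for y
    using g(2)[of y] g(2)[of "- y"] linear_neg[OF g(1), of y] by auto
  then have "bounded_linear g"
    using g(1) by (intro bounded_linear_intro[where K=1]) (auto simp: linear_add linear_scale)
  then have app: "blinfun_apply (Blinfun g) = g" by (rule bounded_linear_Blinfun_apply)
  show ?thesis
    by (rule that[of "Blinfun g"]) (auto intro!: norm_blinfun_bound simp: app b g(3))
qed

section \<open>Solvability of finite systems of norm inequalities\<close>

text \<open>Finitely supported families serve as the product space to which the Hahn-Banach theorem is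
  applied, because they form a real vector space as a type.\<close>

definition poly_mapping_of :: "'i set \<Rightarrow> ('i \<Rightarrow> 'a) \<Rightarrow> ('i, 'a::real_vector) poly_mapping" where
  "poly_mapping_of I v = (\<Sum>i\<in>I. Poly_Mapping.single i (v i))"

lemma lookup_poly_mapping_of: "finite I \<Longrightarrow> Poly_Mapping.lookup (poly_mapping_of I v) i = (if i \<in> I then v i else 0)"
  by (simp add: poly_mapping_of_def lookup_sum lookup_single when_def)

lemma lookup_scaleR_poly_mapping:
  fixes z :: "('i, 'a::real_vector) poly_mapping"
  shows "Poly_Mapping.lookup (c *\<^sub>R z) i = c *\<^sub>R Poly_Mapping.lookup z i"
proof -
  have "finite {i. c *\<^sub>R Poly_Mapping.lookup z i \<noteq> 0}"
    by (rule finite_subset[OF _ finite_lookup[of z]]) auto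
  then show ?thesis
    by (simp add: scaleR_poly_mapping_def Abs_poly_mapping_inverse)
qed

definition pointwise_subspace :: "('i \<Rightarrow> 'a::real_vector) set \<Rightarrow> bool" where
  "pointwise_subspace S \<longleftrightarrow> (\<lambda>i. 0) \<in> S \<and>
     (\<forall>s\<in>S. \<forall>t\<in>S. (\<lambda>i. s i + t i) \<in> S) \<and> (\<forall>c. \<forall>s\<in>S. (\<lambda>i. c *\<^sub>R s i) \<in> S)"

lemma pointwise_subspaceD:
  assumes "pointwise_subspace S"
  shows "(\<lambda>i. 0) \<in> S"
    and "\<And>s t. s \<in> S \<Longrightarrow> t \<in> S \<Longrightarrow> (\<lambda>i. s i + t i) \<in> S"
    and "\<And>c s. s \<in> S \<Longrightarrow> (\<lambda>i. c *\<^sub>R s i) \<in> S"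
  using assms by (auto simp: pointwise_subspace_def)

text \<open>The weighted maximum norm, with weight \<open>1 / \<rho> i\<close> in coordinate \<open>i\<close>, passed to the
  quotient modulo \<open>S\<close>.\<close>

definition quotient_gauge ::
  "'i set \<Rightarrow> ('i \<Rightarrow> 'a::real_normed_vector) set \<Rightarrow> ('i \<Rightarrow> real) \<Rightarrow> ('i, 'a) poly_mapping \<Rightarrow> real" where
  "quotient_gauge I S \<rho> z = Inf {t. 0 \<le> t \<and>
     (\<exists>s\<in>S. \<forall>i\<in>I. norm (Poly_Mapping.lookup z i + s i) \<le> t * \<rho> i)}"

lemma sublinear_quotient_gauge:
  fixes S :: "('i \<Rightarrow> 'a::real_normed_vector) set"
  assumes "finite I" and S: "pointwise_subspace S" and \<rho>: "\<And>i. 0 < \<rho> i"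
  defines "q \<equiv> quotient_gauge I S \<rho>"
  shows "sublinear q"
    and "\<And>z t s. 0 \<le> t \<Longrightarrow> s \<in> S \<Longrightarrow>
           (\<And>i. i \<in> I \<Longrightarrow> norm (Poly_Mapping.lookup z i + s i) \<le> t * \<rho> i) \<Longrightarrow> q z \<le> t"
    and "\<And>z. (\<And>s. s \<in> S \<Longrightarrow> \<exists>i\<in>I. \<rho> i < norm (Poly_Mapping.lookup z i + s i)) \<Longrightarrow> 1 \<le> q z"
proof -
  note zero = pointwise_subspaceD(1)[OF S] and add = pointwise_subspaceD(2)[OF S]
    and scale = pointwise_subspaceD(3)[OF S]
  let ?G = "\<lambda>z :: ('i, 'a) poly_mapping. {t. 0 \<le> t \<and>
    (\<exists>s\<in>S. \<forall>i\<in>I. norm (Poly_Mapping.lookup z i + s i) \<le> t * \<rho> i)}"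
  have bdd: "bdd_below (?G z)" for z
    by (rule bdd_belowI[where m=0]) auto
  have ne: "?G z \<noteq> {}" for z
  proof -
    \<comment> \<open>the sum replaces the maximum of the quotients, which would need \<open>I\<close> to be nonempty\<close>
    let ?t = "\<Sum>i\<in>I. norm (Poly_Mapping.lookup z i) / \<rho> i"
    have "norm (Poly_Mapping.lookup z i) \<le> ?t * \<rho> i" if i: "i \<in> I" for i
    proof -
      have "norm (Poly_Mapping.lookup z i) / \<rho> i \<le> ?t"
        using \<rho> by (intro member_le_sum i \<open>finite I\<close>) (simp add: less_imp_le)
      then show ?thesis using \<rho>[of i] by (simp add: field_simps)
    qed
    moreover have "0 \<le> ?t"
      using \<rho> by (intro sum_nonneg) (simp add: less_imp_le)
    ultimately have "?t \<in> ?G z"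
      using zero by (auto intro!: bexI[where x="\<lambda>i. 0"])
    then show ?thesis by blast
  qed
  have q: "q z = Inf (?G z)" for z by (simp add: q_def quotient_gauge_def)
  show le: "q z \<le> t" if "0 \<le> t" "s \<in> S"
    "\<And>i. i \<in> I \<Longrightarrow> norm (Poly_Mapping.lookup z i + s i) \<le> t * \<rho> i" for z t s
    unfolding q using that by (intro cInf_lower bdd) auto
  have ge: "m \<le> q z" if "\<And>t s. 0 \<le> t \<Longrightarrow> s \<in> S \<Longrightarrow>
    (\<And>i. i \<in> I \<Longrightarrow> norm (Poly_Mapping.lookup z i + s i) \<le> t * \<rho> i) \<Longrightarrow> m \<le> t" for m z
    unfolding q using that by (intro cInf_greatest ne) auto
  show "1 \<le> q z" if far: "\<And>s. s \<in> S \<Longrightarrow> \<exists>i\<in>I. \<rho> i < norm (Poly_Mapping.lookup z i + s i)" for z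
  proof (rule ge)
    fix t s
    assume "0 \<le> t" "s \<in> S"
      and t: "\<And>i. i \<in> I \<Longrightarrow> norm (Poly_Mapping.lookup z i + s i) \<le> t * \<rho> i"
    with far obtain i where i: "i \<in> I" "\<rho> i < norm (Poly_Mapping.lookup z i + s i)" by blast
    with t[of i] have "1 * \<rho> i < t * \<rho> i" by simp
    then show "1 \<le> t" using \<rho>[of i] by simp
  qed
  show "sublinear q"
  proof (rule sublinearI)
    fix x y :: "('i, 'a) poly_mapping"
    have sum_le: "q (x + y) \<le> t + u" if t: "0 \<le> t" "s \<in> S"
      "\<And>i. i \<in> I \<Longrightarrow> norm (Poly_Mapping.lookup x i + s i) \<le> t * \<rho> i"
      and u: "0 \<le> u" "r \<in> S"
      "\<And>i. i \<in> I \<Longrightarrow> norm (Poly_Mapping.lookup y i + r i) \<le> u * \<rho> i" for s r t u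
    proof (rule le[OF _ add[OF t(2) u(2)]])
      fix i assume i: "i \<in> I"
      show "norm (Poly_Mapping.lookup (x + y) i + (s i + r i)) \<le> (t + u) * \<rho> i"
        using norm_triangle_ineq[of "Poly_Mapping.lookup x i + s i" "Poly_Mapping.lookup y i + r i"]
          t(3)[OF i] u(3)[OF i] by (simp add: lookup_add algebra_simps)
    qed (use t(1) u(1) in simp)
    have "q (x + y) - t \<le> q y" if "0 \<le> t" "s \<in> S"
      "\<And>i. i \<in> I \<Longrightarrow> norm (Poly_Mapping.lookup x i + s i) \<le> t * \<rho> i" for s t
      by (rule ge) (use sum_le[OF that] in \<open>simp add: diff_le_eq add.commute\<close>)
    then have "q (x + y) - q y \<le> q x"
      by (intro ge) (simp add: diff_le_eq add.commute)
    then show "q (x + y) \<le> q x + q y" by simp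
  next
    show "q 0 = 0"
      using le[of 0 "\<lambda>i. 0" 0] ge[of 0 0] zero by (intro antisym) auto
  next
    fix c :: real and x :: "('i, 'a) poly_mapping" assume c: "0 < c"
    have "q (c *\<^sub>R x) / c \<le> q x"
    proof (rule ge)
      fix t s assume t: "0 \<le> t" "s \<in> S"
        "\<And>i. i \<in> I \<Longrightarrow> norm (Poly_Mapping.lookup x i + s i) \<le> t * \<rho> i"
      have "q (c *\<^sub>R x) \<le> c * t"
      proof (rule le[OF _ scale[OF t(2), of c]])
        fix i assume i: "i \<in> I"
        have "Poly_Mapping.lookup (c *\<^sub>R x) i + c *\<^sub>R s i = c *\<^sub>R (Poly_Mapping.lookup x i + s i)"
          by (simp add: lookup_scaleR_poly_mapping scaleR_add_right)
        then show "norm (Poly_Mapping.lookup (c *\<^sub>R x) i + c *\<^sub>R s i) \<le> c * t * \<rho> i"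
          using c t(3)[OF i] by simp
      qed (use c t(1) in simp)
      then show "q (c *\<^sub>R x) / c \<le> t"
        using c by (simp add: field_simps)
    qed
    then show "q (c *\<^sub>R x) \<le> c * q x"
      using c by (simp add: field_simps)
  qed
qed

lemma almost_norming_vector:
  fixes f :: "'a::real_normed_vector \<Rightarrow>\<^sub>L real"
  assumes "0 < \<delta>"
  obtains y where "norm y \<le> 1" "norm f - \<delta> \<le> blinfun_apply f y"
proof -
  have "\<exists>y. norm y \<le> 1 \<and> norm f - \<delta> \<le> blinfun_apply f y"
  proof (rule ccontr)
    assume "\<not> ?thesis"
    then have less: "blinfun_apply f y < norm f - \<delta>" if "norm y \<le> 1" for y
      using that by force
    have pos: "0 < norm f - \<delta>"
      using less[of 0] by (simp add: blinfun.zero_right)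
    have "norm f \<le> norm f - \<delta>"
    proof (rule norm_blinfun_bound)
      fix x
      show "norm (blinfun_apply f x) \<le> (norm f - \<delta>) * norm x"
      proof (cases "x = 0")
        case False
        then have "blinfun_apply f (sgn x) < norm f - \<delta>" "blinfun_apply f (- sgn x) < norm f - \<delta>"
          by (auto intro!: less simp: norm_sgn)
        then have "\<bar>blinfun_apply f x\<bar> / norm x \<le> norm f - \<delta>"
          using False by (auto simp: sgn_div_norm blinfun.scaleR_right blinfun.minus_right abs_if field_simps split: if_splits)
        then show ?thesis using False by (simp add: field_simps)
      qed (simp add: blinfun.zero_right)
    qed (use pos in simp)
    with \<open>0 < \<delta>\<close> show False by simp
  qed
  then show ?thesis using that by blast
qed

text \<open>A finite form of Helly's theorem: the distance from \<open>- c\<close> to \<open>S\<close> in a weighted maximum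
  norm is computed by functionals that vanish on \<open>S\<close>, and the dual of that norm is a weighted sum of
  norms. If no \<open>s\<close> worked for the radii \<open>r i + \<epsilon>\<close>, a Hahn-Banach functional \<open>g\<close> for this gauge
  would satisfy \<open>(\<Sum>i\<in>I. (r i + \<epsilon>) * norm (g i)) \<le> 1 \<le> (\<Sum>i\<in>I. g i (c i))\<close>. By \<open>dual\<close> the right-hand
  side is at most \<open>\<Sum>i\<in>I. r i * norm (g i)\<close>, so that every \<open>g i\<close> vanishes, which is absurd.\<close>

theorem Helly_condition:
  fixes S :: "('i \<Rightarrow> 'a::real_normed_vector) set"
  assumes I: "finite I" and S: "pointwise_subspace S"
    and r: "\<And>i. 0 \<le> r i" and \<epsilon>: "0 < \<epsilon>"
    and dual: "\<And>g :: 'i \<Rightarrow> 'a \<Rightarrow>\<^sub>L real.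
      (\<And>s. s \<in> S \<Longrightarrow> (\<Sum>i\<in>I. blinfun_apply (g i) (s i)) = 0) \<Longrightarrow>
      (\<Sum>i\<in>I. blinfun_apply (g i) (c i)) \<le> (\<Sum>i\<in>I. r i * norm (g i))"
  shows "\<exists>s\<in>S. \<forall>i\<in>I. norm (c i + s i) \<le> r i + \<epsilon>"
proof (rule ccontr)
  assume neg: "\<not> ?thesis"
  define \<rho> where "\<rho> i = r i + \<epsilon>" for i
  have \<rho>: "0 < \<rho> i" for i
    using r[of i] \<epsilon> by (simp add: \<rho>_def)
  note zero = pointwise_subspaceD(1)[OF S] and scale = pointwise_subspaceD(3)[OF S]
  note gauge_facts = sublinear_quotient_gauge[of I S \<rho>, OF I S \<rho>]
  obtain F where F: "linear F" and Fq: "\<And>z. F z \<le> quotient_gauge I S \<rho> z"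
    and Fc: "F (poly_mapping_of I c) = quotient_gauge I S \<rho> (poly_mapping_of I c)"
    using Hahn_Banach[OF gauge_facts(1), of "poly_mapping_of I c"] by metis
  have F_le: "F (poly_mapping_of I v) \<le> t" if "0 \<le> t" "s \<in> S" "\<And>i. i \<in> I \<Longrightarrow> norm (v i + s i) \<le> t * \<rho> i"
    for v t s
    by (rule order_trans[OF Fq gauge_facts(2)[OF that(1,2)]]) (simp add: lookup_poly_mapping_of[OF I] that(3))
  have Fc1: "1 \<le> F (poly_mapping_of I c)"
    unfolding Fc
  proof (rule gauge_facts(3))
    fix s assume "s \<in> S"
    with neg obtain i where "i \<in> I" "\<rho> i < norm (c i + s i)"
      by (auto simp: \<rho>_def not_le)
    then show "\<exists>i\<in>I. \<rho> i < norm (Poly_Mapping.lookup (poly_mapping_of I c) i + s i)"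
      by (intro bexI[of _ i]) (simp_all add: lookup_poly_mapping_of[OF I])
  qed
  define g where "g i = Blinfun (\<lambda>y. F (Poly_Mapping.single i y))" for i
  have lin: "linear (\<lambda>y. F (Poly_Mapping.single i y))" for i
  proof (rule linearI)
    fix c :: real and y :: 'a
    have "Poly_Mapping.single i (c *\<^sub>R y) = c *\<^sub>R Poly_Mapping.single i y"
      by (intro poly_mapping_eqI) (simp add: lookup_scaleR_poly_mapping lookup_single when_def)
    then show "F (Poly_Mapping.single i (c *\<^sub>R y)) = c *\<^sub>R F (Poly_Mapping.single i y)"
      by (simp add: linear_scale[OF F])
  qed (simp add: single_add linear_add[OF F])
  have single: "Poly_Mapping.single i y = poly_mapping_of I (\<lambda>j. if j = i then y else 0)" if "i \<in> I" for i y
    using that by (intro poly_mapping_eqI) (auto simp: lookup_poly_mapping_of[OF I] lookup_single when_def)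
  have g: "blinfun_apply (g i) y = F (Poly_Mapping.single i y)" if i: "i \<in> I" for i y
  proof -
    have le: "F (Poly_Mapping.single i y) \<le> norm y / \<rho> i" for y
      unfolding single[OF i] using less_imp_le[OF \<rho>] less_imp_neq[OF \<rho>[of i]]
      by (intro F_le[OF _ zero]) auto
    have "\<bar>F (Poly_Mapping.single i y)\<bar> \<le> norm y / \<rho> i" for y
      using le[of y] le[of "- y"] linear_neg[OF lin, of i y] by (auto simp: abs_if)
    then have "bounded_linear (\<lambda>y. F (Poly_Mapping.single i y))"
      by (intro bounded_linear_intro[where K="1 / \<rho> i"])
        (simp_all add: linear_add[OF lin[of i]] linear_scale[OF lin[of i]])
    then show ?thesis by (simp add: g_def bounded_linear_Blinfun_apply)
  qed
  have F_sum: "F (poly_mapping_of I v) = (\<Sum>i\<in>I. blinfun_apply (g i) (v i))" for v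
    by (simp add: poly_mapping_of_def linear_sum[OF F] g)
  have "(\<Sum>i\<in>I. blinfun_apply (g i) (s i)) = 0" if "s \<in> S" for s
  proof -
    have le: "F (poly_mapping_of I s) \<le> 0" if "s \<in> S" for s
      by (rule F_le[OF _ scale[OF that, of "- 1"]]) auto
    have "F (poly_mapping_of I (\<lambda>i. (- 1) *\<^sub>R s i)) = - F (poly_mapping_of I s)"
      by (simp add: F_sum blinfun.minus_right sum_negf)
    with le[OF that] le[OF scale[OF that, of "- 1"]] show ?thesis by (simp add: F_sum)
  qed
  then have "1 \<le> (\<Sum>i\<in>I. r i * norm (g i))"
    using dual[of g] Fc1 by (simp add: F_sum)
  moreover have "(\<Sum>i\<in>I. \<rho> i * norm (g i)) \<le> 1"
  proof (rule field_le_epsilon)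
    fix e :: real assume e: "0 < e"
    \<comment> \<open>the summand 1 keeps the denominator positive when \<open>I\<close> is empty\<close>
    define \<delta> where "\<delta> = e / (1 + (\<Sum>i\<in>I. \<rho> i))"
    have pos: "0 \<le> (\<Sum>i\<in>I. \<rho> i)" using \<rho> by (intro sum_nonneg) (simp add: less_imp_le)
    with e have "0 < \<delta>" by (simp add: \<delta>_def)
    then have "\<forall>i. \<exists>y. norm y \<le> 1 \<and> norm (g i) - \<delta> \<le> blinfun_apply (g i) y"
      by (metis almost_norming_vector)
    then obtain y where y: "\<And>i. norm (y i) \<le> 1" "\<And>i. norm (g i) - \<delta> \<le> blinfun_apply (g i) (y i)"
      by metis
    have "(\<Sum>i\<in>I. \<rho> i * (norm (g i) - \<delta>)) \<le> (\<Sum>i\<in>I. blinfun_apply (g i) (\<rho> i *\<^sub>R y i))"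
      using y(2) \<rho> by (intro sum_mono) (simp add: blinfun.scaleR_right less_imp_le)
    also have "\<dots> \<le> 1"
      unfolding F_sum[symmetric] using y(1) \<rho>
      by (intro F_le[OF _ zero]) (auto simp: less_imp_le abs_of_pos mult_left_le)
    finally have "(\<Sum>i\<in>I. \<rho> i * norm (g i)) \<le> 1 + \<delta> * (\<Sum>i\<in>I. \<rho> i)"
      by (simp add: algebra_simps sum_subtractf sum_distrib_left)
    also have "\<delta> * (\<Sum>i\<in>I. \<rho> i) \<le> e"
      using pos e by (simp add: \<delta>_def field_simps)
    finally show "(\<Sum>i\<in>I. \<rho> i * norm (g i)) \<le> 1 + e" by simp
  qed
  ultimately have "\<epsilon> * (\<Sum>i\<in>I. norm (g i)) \<le> 0"
    by (simp add: \<rho>_def algebra_simps sum.distrib sum_distrib_left)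
  with \<epsilon> have "(\<Sum>i\<in>I. norm (g i)) \<le> 0"
    by (simp add: mult_le_0_iff)
  then have "\<forall>i\<in>I. g i = 0"
    using sum_nonneg_eq_0_iff[OF I, of "\<lambda>i. norm (g i)"] sum_nonneg[of I "\<lambda>i. norm (g i)"] by auto
  with Fc1 show False by (simp add: F_sum)
qed

section \<open>Finite-dimensional subspaces of normed spaces\<close>

lemma closed_if_compact_cballs:
  fixes V :: "'a::real_normed_vector set"
  assumes "\<And>r. compact (V \<inter> cball 0 r)"
  shows "closed V"
  unfolding closed_sequential_limits
proof (intro allI impI)
  fix x l assume x: "(\<forall>n. x n \<in> V) \<and> x \<longlonglongrightarrow> l"
  then have "bounded (range x)" by (intro convergent_imp_bounded) (auto simp: convergent_def)
  then obtain K where K: "\<And>n. norm (x n) \<le> K" by (auto simp: bounded_iff)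
  have "closed (V \<inter> cball 0 K)"
    using assms by (rule compact_imp_closed)
  then show "l \<in> V"
    using x K by (metis (no_types, lifting) IntD1 IntI closed_sequentially dist_0_norm mem_cball)
qed

text \<open>The witness \<open>d\<close> is a radius of a ball around \<open>b\<close> that misses \<open>V\<close>; the claim is
  then homogeneity.\<close>

lemma coefficient_bound:
  fixes V :: "'a::real_normed_vector set"
  assumes "closed V" "subspace V" "b \<notin> V"
  obtains d where "0 < d" "\<And>a s. s \<in> V \<Longrightarrow> \<bar>a\<bar> * d \<le> norm (a *\<^sub>R b + s)"
proof -
  obtain d where d: "0 < d" "ball b d \<inter> V = {}"
    using assms unfolding closed_def open_contains_ball by (metis ComplI disjoint_eq_subset_Compl)
  have "\<bar>a\<bar> * d \<le> norm (a *\<^sub>R b + s)" if "s \<in> V" for a s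
  proof (cases "a = 0")
    case False
    have "- (inverse a *\<^sub>R s) \<in> V"
      using that \<open>subspace V\<close> by (intro subspace_neg subspace_scale)
    then have "d \<le> norm (b + inverse a *\<^sub>R s)"
      using d(2) by (force simp: dist_norm not_less)
    moreover have "a *\<^sub>R b + s = a *\<^sub>R (b + inverse a *\<^sub>R s)"
      using False by (simp add: scaleR_add_right)
    ultimately show ?thesis by (simp add: mult_left_mono)
  qed simp
  with d(1) show ?thesis by (rule that)
qed

lemma span_insertE:
  assumes "x \<in> span (insert b B)"
  obtains a s where "x = a *\<^sub>R b + s" "s \<in> span B"
proof -
  from assms obtain a where "x - a *\<^sub>R b \<in> span B"
    by (auto simp: span_insert)
  then show ?thesis by (intro that[of a "x - a *\<^sub>R b"]) simp_all
qed

text \<open>Adding one vector \<open>b\<close> keeps balls compact: by \<open>coefficient_bound\<close> the coefficient of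
  \<open>b\<close> and the remaining part are bounded on the ball, which is therefore a closed subset of a
  continuous image of an interval times a smaller ball. The closedness needed for
  \<open>coefficient_bound\<close> is itself a consequence of the induction hypothesis.\<close>

lemma compact_finite_span_cball:
  fixes B :: "'a::real_normed_vector set"
  assumes "finite B"
  shows "compact (span B \<inter> cball 0 r)"
  using assms
proof (induction B arbitrary: r)
  case empty
  have "span {} \<inter> cball 0 r \<subseteq> {0::'a}" by auto
  then have "finite (span {} \<inter> cball (0::'a) r)" by (rule finite_subset) simp
  then show ?case by (rule finite_imp_compact)
next
  case (insert b B)
  show ?case
  proof (cases "b \<in> span B")
    case True
    then show ?thesis using insert.IH by (simp add: span_redundant)
  next
    case False
    obtain d where d: "0 < d" and coeff: "\<And>a s. s \<in> span B \<Longrightarrow> \<bar>a\<bar> * d \<le> norm (a *\<^sub>R b + s)"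
      using coefficient_bound[OF closed_if_compact_cballs[OF insert.IH] subspace_span False] by metis
    let ?m = "r / d" and ?R = "r + r / d * norm b"
    let ?K = "(\<lambda>(a, s). a *\<^sub>R b + s) ` (cball 0 ?m \<times> (span B \<inter> cball 0 ?R))"
    have "compact ?K"
      by (intro compact_continuous_image compact_Times compact_cball insert.IH)
         (auto simp: case_prod_beta intro!: continuous_intros)
    moreover have "span (insert b B) \<inter> cball 0 r = ?K \<inter> cball 0 r"
    proof (intro equalityI subsetI)
      fix x assume x: "x \<in> span (insert b B) \<inter> cball 0 r"
      then obtain a s where as: "x = a *\<^sub>R b + s" "s \<in> span B"
        by (auto elim: span_insertE)
      have a: "\<bar>a\<bar> \<le> ?m"
        using coeff[OF as(2), of a] x d as(1) by (simp add: field_simps)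
      have "norm s = norm (x - a *\<^sub>R b)" by (simp add: as(1))
      also have "\<dots> \<le> norm x + \<bar>a\<bar> * norm b"
        by (metis norm_scaleR norm_triangle_ineq4)
      also have "\<dots> \<le> ?R"
        using x a by (intro add_mono mult_right_mono) auto
      finally show "x \<in> ?K \<inter> cball 0 r"
        using x as a by (auto intro!: image_eqI[where x="(a, s)"])
    next
      fix x assume x: "x \<in> ?K \<inter> cball 0 r"
      have "a *\<^sub>R b + s \<in> span (insert b B)" if "s \<in> span B" for a s
        using that span_mono[of B "insert b B"] by (intro span_add span_scale) (auto intro: span_base)
      with x show "x \<in> span (insert b B) \<inter> cball 0 r" by auto
    qed
    ultimately show ?thesis by (metis compact_Int_closed closed_cball)
  qed
qed

lemma linear_bounded_on_finite_span:
  fixes T :: "'a::real_normed_vector \<Rightarrow> 'b::real_normed_vector"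
  assumes "finite B" "linear T"
  shows "\<exists>K\<ge>0. \<forall>e\<in>span B. norm (T e) \<le> K * norm e"
  using assms(1)
proof (induction B)
  case empty
  then show ?case using linear_0[OF \<open>linear T\<close>] by (intro exI[of _ 0]) auto
next
  case (insert b B)
  show ?case
  proof (cases "b \<in> span B")
    case True
    then show ?thesis using insert.IH by (simp add: span_redundant)
  next
    case False
    have "closed (span B)"
      using insert.hyps(1) by (intro closed_if_compact_cballs compact_finite_span_cball)
    then obtain d where d: "0 < d"
      and coeff: "\<And>a s. s \<in> span B \<Longrightarrow> \<bar>a\<bar> * d \<le> norm (a *\<^sub>R b + s)"
      using coefficient_bound[OF _ subspace_span False] by metis
    obtain K where K: "0 \<le> K" "\<And>e. e \<in> span B \<Longrightarrow> norm (T e) \<le> K * norm e"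
      using insert.IH by blast
    let ?L = "norm (T b) / d + K * (1 + norm b / d)"
    have "norm (T e) \<le> ?L * norm e" if e: "e \<in> span (insert b B)" for e
    proof -
      obtain a s where as: "e = a *\<^sub>R b + s" "s \<in> span B"
        using e by (rule span_insertE)
      have a: "\<bar>a\<bar> \<le> norm e / d"
        using coeff[OF as(2), of a] d as(1) by (simp add: field_simps)
      have "norm s = norm (e - a *\<^sub>R b)" by (simp add: as(1))
      also have "\<dots> \<le> norm e + \<bar>a\<bar> * norm b"
        by (metis norm_scaleR norm_triangle_ineq4)
      also have "\<dots> \<le> norm e + norm e / d * norm b"
        using a by (intro add_mono mult_right_mono) auto
      finally have s: "norm s \<le> norm e + norm e / d * norm b" .
      have "T e = a *\<^sub>R T b + T s"
        by (simp add: as(1) linear_add[OF \<open>linear T\<close>] linear_scale[OF \<open>linear T\<close>])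
      then have "norm (T e) \<le> \<bar>a\<bar> * norm (T b) + norm (T s)"
        by (metis norm_scaleR norm_triangle_ineq)
      also have "\<dots> \<le> norm e / d * norm (T b) + K * (norm e + norm e / d * norm b)"
        using a s K as(2) by (intro add_mono mult_right_mono order_trans[OF K(2)] mult_left_mono) auto
      finally show ?thesis by (simp add: algebra_simps)
    qed
    moreover have "0 \<le> ?L" using d K(1) by auto
    ultimately show ?thesis by blast
  qed
qed

lemma finite_net_of_ball:
  fixes B :: "'a::real_normed_vector set"
  assumes "finite B" "0 < \<delta>"
  obtains N where "finite N" "N \<subseteq> span B \<inter> cball 0 1"
    "\<And>e. e \<in> span B \<Longrightarrow> norm e \<le> 1 \<Longrightarrow> \<exists>n\<in>N. norm (e - n) \<le> \<delta>"
proof -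
  let ?K = "span B \<inter> cball 0 1"
  obtain N where N: "finite N" "N \<subseteq> ?K" "?K \<subseteq> (\<Union>n\<in>N. ball n \<delta>)"
    using seq_compact_imp_totally_bounded[OF compact_imp_seq_compact, OF compact_finite_span_cball]
      assms by metis
  have "\<exists>n\<in>N. norm (e - n) \<le> \<delta>" if "e \<in> span B" "norm e \<le> 1" for e
  proof -
    have "e \<in> ?K" using that by simp
    with N(3) obtain n where "n \<in> N" "dist n e < \<delta>" by auto
    then show ?thesis by (auto simp: dist_norm norm_minus_commute intro!: bexI[of _ n])
  qed
  with N(1,2) show ?thesis by (rule that)
qed

text \<open>Extend a basis of \<open>X \<inter> span B\<close> to a basis of \<open>span B\<close>. The added vectors form
  \<open>D\<close>, the \<open>\<phi> d\<close> are their coordinates, and \<open>T\<close> is the projection that kills \<open>D\<close>. Hence the linear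
  maps \<open>span B \<rightarrow> X\<close> that fix \<open>X \<inter> span B\<close> are parametrised by their values on \<open>D\<close>, which are
  arbitrary vectors of \<open>X\<close>.\<close>

lemma finite_dim_decomposition:
  fixes X :: "'a::real_vector set"
  assumes X: "subspace X" and B: "finite B"
  obtains T D and \<phi> :: "'a \<Rightarrow> 'a \<Rightarrow> real"
  where "linear T" "T ` span B \<subseteq> X" "\<And>x. x \<in> X \<inter> span B \<Longrightarrow> T x = x"
    "finite D" "\<And>d. linear (\<phi> d)" "\<And>d x. d \<in> D \<Longrightarrow> x \<in> X \<inter> span B \<Longrightarrow> \<phi> d x = 0"
    "\<And>e. e \<in> span B \<Longrightarrow> e = T e + (\<Sum>d\<in>D. \<phi> d e *\<^sub>R d)"
proof -
  obtain C0 where C0: "C0 \<subseteq> X \<inter> span B" "independent C0" "X \<inter> span B \<subseteq> span C0"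
    using real_vector.maximal_independent_subset[of "X \<inter> span B"] by blast
  obtain C where C: "C0 \<subseteq> C" "C \<subseteq> span B" "independent C" "span B \<subseteq> span C"
    using real_vector.maximal_independent_subset_extend[of C0 "span B"] C0 by blast
  have "finite C"
    using real_vector.independent_span_bound[OF B C(3,2)] by simp
  have "\<forall>d. \<exists>g. linear g \<and> (\<forall>c\<in>C. g c = (if c = d then 1 else 0 :: real))"
    by (intro allI linear_independent_extend C(3))
  from choice[OF this] obtain \<phi> :: "'a \<Rightarrow> 'a \<Rightarrow> real"
    where \<phi>: "\<And>d. linear (\<phi> d)" "\<And>d c. c \<in> C \<Longrightarrow> \<phi> d c = (if c = d then 1 else 0)"
    by blast
  obtain T where T: "linear T" "\<And>c. c \<in> C \<Longrightarrow> T c = (if c \<in> C0 then c else 0 :: 'a)"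
    using linear_independent_extend[OF C(3), of "\<lambda>c. if c \<in> C0 then c else 0"] by blast
  show ?thesis
  proof (rule that[of T "C - C0" \<phi>])
    have "T c \<in> X" if "c \<in> C" for c
      using that C0(1) X by (auto simp: T(2) subspace_0)
    then have "span (T ` C) \<subseteq> X"
      using X by (intro span_minimal) auto
    then show "T ` span B \<subseteq> X"
      using C(4) linear_span_image[OF T(1), of C] by blast
    show "T x = x" if "x \<in> X \<inter> span B" for x
      by (rule linear_eq_on_span[OF T(1) linear_ident, of C0]) (use that C0(3) C(1) T(2) in auto)
    show "\<phi> d x = 0" if "d \<in> C - C0" "x \<in> X \<inter> span B" for d x
      by (rule linear_eq_0_on_span[OF \<phi>(1), of C0]) (use that C0(3) C(1) \<phi>(2) in auto)
    show "e = T e + (\<Sum>d\<in>C - C0. \<phi> d e *\<^sub>R d)" if "e \<in> span B" for e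
    proof (rule linear_eq_on_span[OF linear_ident, of _ C])
      show "linear (\<lambda>e. T e + (\<Sum>d\<in>C - C0. \<phi> d e *\<^sub>R d))"
        by (intro linear_compose_add[OF T(1)] linear_compose_sum ballI)
          (auto intro!: linearI simp: linear_add[OF \<phi>(1)] linear_scale[OF \<phi>(1)] scaleR_add_left)
      show "c = T c + (\<Sum>d\<in>C - C0. \<phi> d c *\<^sub>R d)" if "c \<in> C" for c
        using that \<open>finite C\<close>
        by (simp add: T(2) \<phi>(2) if_distrib[of "\<lambda>r. r *\<^sub>R _"] sum.delta' cong: if_cong)
    qed (use that C(4) in auto)
  qed (use T \<phi> \<open>finite C\<close> in auto)
qed

section \<open>Almost isometric u-ideals are strict u-ideals\<close>

lemma le_if_le_one_plus_mult:
  fixes a b :: real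
  assumes "0 \<le> b" "\<And>\<epsilon>. 0 < \<epsilon> \<Longrightarrow> a \<le> (1 + \<epsilon>) * b"
  shows "a \<le> b"
proof (rule field_le_epsilon)
  fix e :: real assume e: "0 < e"
  have "a \<le> (1 + e / (b + 1)) * b"
    using assms e by (intro assms(2)) auto
  also have "\<dots> = b + e * (b / (b + 1))" by (simp add: algebra_simps)
  also have "\<dots> \<le> b + e"
    using assms(1) e by (simp add: field_simps)
  finally show "a \<le> b + e" .
qed

text \<open>Bilinear forms \<open>\<Phi> (f, e)\<close> with the properties that \<open>f (T e)\<close> has for an operator
  \<open>T\<close> satisfying the conditions of an almost isometric u-ideal on \<open>E\<close> with parameter \<open>\<epsilon>\<close>, except for
  the lower bound on \<open>norm (T e)\<close>. Each property is a closed condition on \<open>\<Phi>\<close> in the topology of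
  pointwise convergence, hence survives a compactness argument; the lower bound is not of this kind.\<close>

definition approx_dual :: "'a::real_normed_vector set \<Rightarrow> 'a set \<Rightarrow> real \<Rightarrow>
    (('a \<Rightarrow>\<^sub>L real) \<times> 'a \<Rightarrow> real) set" where
  "approx_dual X E \<epsilon> = {\<Phi>.
     (\<forall>f. \<forall>e\<in>E. \<forall>e'\<in>E. \<Phi> (f, e + e') = \<Phi> (f, e) + \<Phi> (f, e')) \<and>
     (\<forall>f c. \<forall>e\<in>E. \<Phi> (f, c *\<^sub>R e) = c * \<Phi> (f, e)) \<and>
     (\<forall>f g. \<forall>e\<in>E. \<Phi> (f + g, e) = \<Phi> (f, e) + \<Phi> (g, e)) \<and>
     (\<forall>f c. \<forall>e\<in>E. \<Phi> (c *\<^sub>R f, e) = c * \<Phi> (f, e)) \<and>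
     (\<forall>f. \<forall>e\<in>E. \<bar>\<Phi> (f, e)\<bar> \<le> (1 + \<epsilon>) * (norm f * norm e)) \<and>
     (\<forall>f. \<forall>e\<in>E. \<bar>blinfun_apply f e - 2 * \<Phi> (f, e)\<bar> \<le> (1 + \<epsilon>) * (norm f * norm e)) \<and>
     (\<forall>f. \<forall>e\<in>X \<inter> E. \<Phi> (f, e) = blinfun_apply f e) \<and>
     (\<forall>f\<in>annihilator X. \<forall>e\<in>E. \<Phi> (f, e) = 0)}"

lemma approx_dualD:
  assumes "\<Phi> \<in> approx_dual X E \<epsilon>" "e \<in> E"
  shows "e' \<in> E \<Longrightarrow> \<Phi> (f, e + e') = \<Phi> (f, e) + \<Phi> (f, e')"
    and "\<Phi> (f, c *\<^sub>R e) = c * \<Phi> (f, e)"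
    and "\<Phi> (f + g, e) = \<Phi> (f, e) + \<Phi> (g, e)"
    and "\<Phi> (c *\<^sub>R f, e) = c * \<Phi> (f, e)"
    and "\<bar>\<Phi> (f, e)\<bar> \<le> (1 + \<epsilon>) * (norm f * norm e)"
    and "\<bar>blinfun_apply f e - 2 * \<Phi> (f, e)\<bar> \<le> (1 + \<epsilon>) * (norm f * norm e)"
    and "e \<in> X \<Longrightarrow> \<Phi> (f, e) = blinfun_apply f e"
    and "f \<in> annihilator X \<Longrightarrow> \<Phi> (f, e) = 0"
  using assms unfolding approx_dual_def by blast+

lemma closed_approx_dual: "closed (approx_dual X E \<epsilon>)"
  unfolding approx_dual_def Ball_def
  by (intro closed_Collect_conj closed_Collect_all closed_Collect_imp open_Collect_const
      closed_Collect_eq closed_Collect_le continuous_on_add continuous_on_diff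
      continuous_on_mult continuous_on_rabs continuous_on_const continuous_on_product_coordinates)

lemma approx_dual_mono:
  assumes "E \<subseteq> E'" "\<epsilon>' \<le> \<epsilon>"
  shows "approx_dual X E' \<epsilon>' \<subseteq> approx_dual X E \<epsilon>"
proof
  fix \<Phi> assume \<Phi>: "\<Phi> \<in> approx_dual X E' \<epsilon>'"
  have le: "(1 + \<epsilon>') * (norm f * norm e) \<le> (1 + \<epsilon>) * (norm f * norm e)"
    for f :: "'a \<Rightarrow>\<^sub>L real" and e :: 'a
    using assms by (intro mult_right_mono) auto
  note D = approx_dualD[OF \<Phi> subsetD[OF \<open>E \<subseteq> E'\<close>]]
  show "\<Phi> \<in> approx_dual X E \<epsilon>"
    unfolding approx_dual_def mem_Collect_eq
    using D(1-4,7,8) subsetD[OF \<open>E \<subseteq> E'\<close>] order_trans[OF D(5) le] order_trans[OF D(6) le]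
    by (intro conjI allI ballI) auto
qed

lemma approx_dual_nonempty:
  assumes "ai_u_ideal X" "finite B" "0 < \<epsilon>"
  obtains \<Phi> where "\<Phi> \<in> approx_dual X (span B) \<epsilon>"
    "\<And>f e. \<bar>\<Phi> (f, e)\<bar> \<le> (1 + \<epsilon>) * (norm f * norm e)"
proof -
  have "finite_dim_subspace (span B)"
    using \<open>finite B\<close> by (auto simp: finite_dim_subspace_def)
  then obtain T where lin: "linear_operator_between (span B) X T"
    and fix_X: "\<And>e. e \<in> X \<inter> span B \<Longrightarrow> T e = e"
    and le: "\<And>e. e \<in> span B \<Longrightarrow> norm (T e) \<le> (1 + \<epsilon>) * norm e"
    and u: "\<And>e. e \<in> span B \<Longrightarrow> norm (e - 2 *\<^sub>R T e) \<le> (1 + \<epsilon>) * norm e"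
    using assms unfolding ai_u_ideal_def by meson
  define \<Phi> :: "('a \<Rightarrow>\<^sub>L real) \<times> 'a \<Rightarrow> real"
    where "\<Phi> = (\<lambda>(f, e). if e \<in> span B then blinfun_apply f (T e) else 0)"
  have \<Phi>: "\<Phi> (f, e) = blinfun_apply f (T e)" if "e \<in> span B" for f e
    using that by (simp add: \<Phi>_def)
  have T: "T (e + e') = T e + T e'" "T (c *\<^sub>R e) = c *\<^sub>R T e" "T e \<in> X"
    if "e \<in> span B" "e' \<in> span B" for e e' c
    using lin that by (auto simp: linear_operator_between_def)
  have apply_le: "\<bar>blinfun_apply f z\<bar> \<le> (1 + \<epsilon>) * (norm f * norm e)"
    if "norm z \<le> (1 + \<epsilon>) * norm e" for f :: "'a \<Rightarrow>\<^sub>L real" and z e :: 'a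
  proof -
    have "\<bar>blinfun_apply f z\<bar> \<le> norm f * norm z"
      using norm_blinfun[of f z] by simp
    also have "\<dots> \<le> norm f * ((1 + \<epsilon>) * norm e)"
      using that by (intro mult_left_mono) auto
    finally show ?thesis by (simp add: mult_ac)
  qed
  have u_le: "\<bar>blinfun_apply f e - 2 * blinfun_apply f (T e)\<bar> \<le> (1 + \<epsilon>) * (norm f * norm e)"
    if "e \<in> span B" for f :: "'a \<Rightarrow>\<^sub>L real" and e
    using apply_le[OF u[OF that], of f] by (simp add: blinfun.diff_right blinfun.scaleR_right)
  show ?thesis
  proof (rule that)
    show "\<Phi> \<in> approx_dual X (span B) \<epsilon>"
      unfolding approx_dual_def
      by (auto simp: \<Phi> T span_add span_scale blinfun.bilinear_simps fix_X annihilator_def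
          intro!: apply_le le u_le)
    show "\<bar>\<Phi> (f, e)\<bar> \<le> (1 + \<epsilon>) * (norm f * norm e)" for f e
    proof (cases "e \<in> span B")
      case True
      then show ?thesis by (simp add: \<Phi> apply_le le)
    next
      case False
      then show ?thesis using \<open>0 < \<epsilon>\<close> by (simp add: \<Phi>_def)
    qed
  qed
qed

text \<open>Compactness of a product of intervals. The sets \<open>approx_dual X (span B) \<epsilon>\<close> decrease when
  \<open>B\<close> grows and \<open>\<epsilon>\<close> shrinks, so finitely many of them contain a common one, and that one meets the
  product. Restricting to \<open>\<epsilon> \<le> 1\<close> makes the intervals independent of \<open>\<epsilon>\<close>.\<close>

lemma approx_dual_limit:
  assumes ai: "ai_u_ideal X"
  shows "\<exists>\<Phi>. \<forall>B \<epsilon>. finite B \<longrightarrow> 0 < \<epsilon> \<longrightarrow> \<Phi> \<in> approx_dual X (span B) \<epsilon>"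
proof -
  let ?S = "\<lambda>(f :: 'a \<Rightarrow>\<^sub>L real, e :: 'a). {- (2 * (norm f * norm e)) .. 2 * (norm f * norm e)}"
  let ?K = "PiE UNIV ?S"
  let ?I = "{B :: 'a set. finite B} \<times> {0 <.. 1 :: real}"
  let ?C = "\<lambda>(B, \<epsilon>). approx_dual X (span B) \<epsilon>"
  have "compactin (product_topology (\<lambda>i. euclidean) UNIV) ?K"
    unfolding compactin_PiE by (auto simp: compactin_euclidean_iff)
  then have "compact ?K"
    by (simp add: euclidean_product_topology compactin_euclidean_iff)
  then have "?K \<inter> (\<Inter>i\<in>?I. ?C i) \<noteq> {}"
  proof (rule compact_imp_fip_image)
    show "closed (?C i)" for i
      by (cases i) (simp add: closed_approx_dual)
    fix J assume J: "finite J" "J \<subseteq> ?I"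
    let ?B = "\<Union> (fst ` J)" and ?\<epsilon> = "Min (insert 1 (snd ` J))"
    have \<epsilon>: "0 < ?\<epsilon>" "?\<epsilon> \<le> 1"
      using J by (auto simp: Min_gr_iff)
    have "finite ?B" using J by auto
    from approx_dual_nonempty[OF ai this \<epsilon>(1)]
    obtain \<Phi> where \<Phi>: "\<Phi> \<in> approx_dual X (span ?B) ?\<epsilon>"
      "\<And>f e. \<bar>\<Phi> (f, e)\<bar> \<le> (1 + ?\<epsilon>) * (norm f * norm e)" by blast
    have "\<Phi> \<in> ?C i" if "i \<in> J" for i
    proof -
      have "approx_dual X (span ?B) ?\<epsilon> \<subseteq> approx_dual X (span (fst i)) (snd i)"
        using that J(1) by (intro approx_dual_mono span_mono Min_le) auto
      then show ?thesis using \<Phi>(1) by (auto simp: case_prod_beta)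
    qed
    moreover have "\<Phi> \<in> ?K"
    proof (rule PiE_I)
      fix i :: "('a \<Rightarrow>\<^sub>L real) \<times> 'a"
      obtain f e where i: "i = (f, e)" by (cases i)
      have "(1 + ?\<epsilon>) * (norm f * norm e) \<le> 2 * (norm f * norm e)"
        using \<epsilon>(2) by (intro mult_right_mono) auto
      with \<Phi>(2)[of f e] have "\<bar>\<Phi> (f, e)\<bar> \<le> 2 * (norm f * norm e)"
        by (rule order_trans)
      then show "\<Phi> i \<in> ?S i"
        by (auto simp: i abs_le_iff)
    qed simp
    ultimately show "?K \<inter> (\<Inter>i\<in>J. ?C i) \<noteq> {}" by blast
  qed
  then obtain \<Phi> where \<Phi>: "\<And>i. i \<in> ?I \<Longrightarrow> \<Phi> \<in> ?C i" by blast
  show ?thesis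
  proof (intro exI allI impI)
    fix B :: "'a set" and \<epsilon> :: real assume "finite B" "0 < \<epsilon>"
    then have "\<Phi> \<in> approx_dual X (span B) (min \<epsilon> 1)"
      using \<Phi>[of "(B, min \<epsilon> 1)"] by simp
    then show "\<Phi> \<in> approx_dual X (span B) \<epsilon>"
      using approx_dual_mono[of "span B" "span B" "min \<epsilon> 1" \<epsilon> X] by auto
  qed
qed

text \<open>The limit form belongs to \<open>approx_dual\<close> for every \<open>\<epsilon>\<close> and every finite-dimensional
  subspace, so it is bilinear everywhere and its bounds hold with \<open>\<epsilon> = 0\<close>.\<close>

lemma u_projection_of_ai_u_ideal:
  fixes X :: "'a::real_normed_vector set"
  assumes ai: "ai_u_ideal X"
  obtains P :: "('a \<Rightarrow>\<^sub>L real) \<Rightarrow>\<^sub>L ('a \<Rightarrow>\<^sub>L real)"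
  where "norm P \<le> 1" "norm (id_blinfun - 2 *\<^sub>R P) \<le> 1"
    "\<And>f x. x \<in> X \<Longrightarrow> blinfun_apply (blinfun_apply P f) x = blinfun_apply f x"
    "\<And>f. f \<in> annihilator X \<Longrightarrow> blinfun_apply P f = 0"
proof -
  obtain \<Phi> where \<Phi>: "\<And>B \<epsilon>. finite B \<Longrightarrow> 0 < \<epsilon> \<Longrightarrow> \<Phi> \<in> approx_dual X (span B) \<epsilon>"
    using approx_dual_limit[OF ai] by blast
  have in_span: "y \<in> span {y, y'}" "y \<in> span {y', y}" for y y' :: 'a
    by (simp_all add: span_base)
  have \<Phi>_pair: "\<Phi> \<in> approx_dual X (span {y, y'}) \<epsilon>" if "0 < \<epsilon>" for y y' \<epsilon>
    using that by (intro \<Phi>) auto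
  note D = approx_dualD[OF \<Phi>_pair[OF zero_less_one] in_span(1)]
  have add: "\<Phi> (f, y + y') = \<Phi> (f, y) + \<Phi> (f, y')" for f y y'
    by (rule D(1)[OF in_span(2)])
  have scale: "\<Phi> (f, c *\<^sub>R y) = c * \<Phi> (f, y)" for f c y
    by (rule D(2))
  have add_left: "\<Phi> (f + g, y) = \<Phi> (f, y) + \<Phi> (g, y)" for f g y
    by (rule D(3))
  have scale_left: "\<Phi> (c *\<^sub>R f, y) = c * \<Phi> (f, y)" for f c y
    by (rule D(4))
  have \<Phi>_X: "\<Phi> (f, y) = blinfun_apply f y" if "y \<in> X" for f y
    using that by (rule D(7))
  have \<Phi>_ann: "\<Phi> (f, y) = 0" if "f \<in> annihilator X" for f y
    using that by (rule D(8))
  have bound: "\<bar>\<Phi> (f, y)\<bar> \<le> norm f * norm y" for f y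
    by (rule le_if_le_one_plus_mult[OF _ approx_dualD(5)[OF \<Phi>_pair in_span(1)]]) simp_all
  have u_bound: "\<bar>blinfun_apply f y - 2 * \<Phi> (f, y)\<bar> \<le> norm f * norm y" for f y
    by (rule le_if_le_one_plus_mult[OF _ approx_dualD(6)[OF \<Phi>_pair in_span(1)]]) simp_all
  define p where "p f = Blinfun (\<lambda>y. \<Phi> (f, y))" for f
  have p: "blinfun_apply (p f) y = \<Phi> (f, y)" for f y
  proof -
    have "bounded_linear (\<lambda>y. \<Phi> (f, y))"
      by (rule bounded_linear_intro[where K="norm f"])
        (use bound[of f] in \<open>auto simp: add scale mult.commute\<close>)
    then show ?thesis by (simp add: p_def bounded_linear_Blinfun_apply)
  qed
  have norm_p: "norm (p f) \<le> norm f" for f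
    using bound by (intro norm_blinfun_bound) (auto simp: p)
  have "bounded_linear p"
    by (rule bounded_linear_intro[where K=1])
      (auto intro!: blinfun_eqI norm_p simp: p add_left scale_left blinfun.bilinear_simps)
  then have P: "blinfun_apply (Blinfun p) = p"
    by (rule bounded_linear_Blinfun_apply)
  show ?thesis
  proof (rule that[of "Blinfun p"])
    show "norm (Blinfun p) \<le> 1"
      by (rule norm_blinfun_bound) (auto simp: P norm_p)
    show "norm (id_blinfun - 2 *\<^sub>R Blinfun p) \<le> 1"
    proof (rule norm_blinfun_bound)
      fix f :: "'a \<Rightarrow>\<^sub>L real"
      have "norm (f - 2 *\<^sub>R p f) \<le> norm f"
        using u_bound[of f] by (intro norm_blinfun_bound) (auto simp: p blinfun.bilinear_simps)
      then show "norm (blinfun_apply (id_blinfun - 2 *\<^sub>R Blinfun p) f) \<le> 1 * norm f"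
        by (simp add: blinfun.bilinear_simps P)
    qed simp
    show "blinfun_apply (blinfun_apply (Blinfun p) f) x = blinfun_apply f x" if "x \<in> X" for f x
      using that by (simp add: P p \<Phi>_X)
    show "blinfun_apply (Blinfun p) f = 0" if "f \<in> annihilator X" for f
      using that by (intro blinfun_eqI) (simp add: P p \<Phi>_ann blinfun.bilinear_simps)
  qed
qed

text \<open>A single local operator \<open>T\<close> on the line through \<open>y\<close> suffices. With \<open>f\<close> norming
  \<open>T y\<close>, the functional \<open>P f\<close> takes the value \<open>norm (T y)\<close> at \<open>T y\<close>, and it cannot lose more than
  \<open>norm (y - 2 *\<^sub>R T y)\<close> between \<open>2 *\<^sub>R T y\<close> and \<open>y\<close>.\<close>

lemma range_of_u_projection_norming:
  fixes X :: "'a::real_normed_vector set"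
  assumes ai: "ai_u_ideal X" and norm_P: "norm P \<le> 1"
    and P_X: "\<And>f x. x \<in> X \<Longrightarrow> blinfun_apply (blinfun_apply P f) x = blinfun_apply f x"
  shows "one_norming (range (blinfun_apply P))"
  unfolding one_norming_def
proof
  fix y :: 'a
  let ?S = "{\<bar>blinfun_apply f y\<bar> | f. f \<in> range (blinfun_apply P) \<and> norm f \<le> 1}"
  have upper: "s \<le> norm y" if s: "s \<in> ?S" for s
  proof -
    obtain f :: "'a \<Rightarrow>\<^sub>L real" where f: "s = \<bar>blinfun_apply f y\<bar>" "norm f \<le> 1"
      using s by (elim CollectE exE conjE) (rule that)
    have "s \<le> norm f * norm y" using norm_blinfun[of f y] by (simp add: f)
    also have "\<dots> \<le> 1 * norm y" using f(2) by (intro mult_right_mono) auto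
    finally show ?thesis by simp
  qed
  have lower: "norm y \<le> Sup ?S"
  proof (rule field_le_epsilon)
    fix e :: real assume e: "0 < e"
    define \<epsilon> where "\<epsilon> = e / (3 * (norm y + 1))"
    have \<epsilon>: "0 < \<epsilon>" using e by (simp add: \<epsilon>_def add_nonneg_pos)
    have \<epsilon>e: "3 * (\<epsilon> * norm y) \<le> e"
    proof -
      have pos: "0 < norm y + 1" by (simp add: add_nonneg_pos)
      then have "3 * (\<epsilon> * norm y) = e * (norm y / (norm y + 1))"
        by (simp add: \<epsilon>_def field_simps)
      also have "\<dots> \<le> e"
        using e pos by (intro mult_left_le) auto
      finally show ?thesis .
    qed
    have "finite_dim_subspace (span {y})" by (auto simp: finite_dim_subspace_def)
    with ai \<epsilon> obtain T where T: "linear_operator_between (span {y}) X T"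
      and iso: "\<And>z. z \<in> span {y} \<Longrightarrow> inverse (1 + \<epsilon>) * norm z \<le> norm (T z)"
      and u: "\<And>z. z \<in> span {y} \<Longrightarrow> norm (z - 2 *\<^sub>R T z) \<le> (1 + \<epsilon>) * norm z"
      unfolding ai_u_ideal_def by meson
    have y: "y \<in> span {y}" by (simp add: span_base)
    with T have TX: "T y \<in> X" by (auto simp: linear_operator_between_def)
    obtain f :: "'a \<Rightarrow>\<^sub>L real" where f: "norm f \<le> 1" "blinfun_apply f (T y) = norm (T y)"
      by (rule norming_functional)
    let ?g = "blinfun_apply P f"
    have "norm ?g \<le> norm P * norm f" by (rule norm_blinfun)
    also have "\<dots> \<le> 1 * 1" using norm_P f(1) by (intro mult_mono) auto
    finally have g: "norm ?g \<le> 1" by simp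
    have "\<bar>blinfun_apply ?g (y - 2 *\<^sub>R T y)\<bar> \<le> norm ?g * norm (y - 2 *\<^sub>R T y)"
      using norm_blinfun[of ?g] by simp
    also have "\<dots> \<le> 1 * ((1 + \<epsilon>) * norm y)"
      using g u[OF y] by (intro mult_mono) auto
    finally have "2 * blinfun_apply ?g (T y) - (1 + \<epsilon>) * norm y \<le> blinfun_apply ?g y"
      by (simp add: blinfun.bilinear_simps)
    moreover have "blinfun_apply ?g (T y) = norm (T y)"
      by (simp add: P_X TX f(2))
    moreover have "(1 - \<epsilon>) * norm y \<le> norm (T y)"
    proof -
      have "(1 - \<epsilon>) * (1 + \<epsilon>) \<le> 1" by (simp add: algebra_simps)
      then have "1 - \<epsilon> \<le> inverse (1 + \<epsilon>)" using \<epsilon> by (simp add: field_simps)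
      then have "(1 - \<epsilon>) * norm y \<le> inverse (1 + \<epsilon>) * norm y"
        by (intro mult_right_mono) auto
      with iso[OF y] show ?thesis by simp
    qed
    ultimately have "norm y - 3 * (\<epsilon> * norm y) \<le> blinfun_apply ?g y"
      by (simp add: algebra_simps)
    moreover have "\<bar>blinfun_apply ?g y\<bar> \<le> Sup ?S"
      using g upper by (intro cSup_upper bdd_aboveI[of _ "norm y"]) auto
    ultimately show "norm y \<le> Sup ?S + e" using \<epsilon>e by linarith
  qed
  have "?S \<noteq> {}"
    by (auto intro!: exI[of _ "blinfun_apply P 0"] simp: blinfun.zero_right)
  then have "Sup ?S \<le> norm y"
    using upper by (intro cSup_least) auto
  with lower show "norm y = Sup ?S" by simp
qed

text \<open>Since \<open>P f\<close> and \<open>f\<close> agree on \<open>X\<close>, their difference is killed by \<open>P\<close>, which makes \<open>P\<close> a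
  projection with kernel the annihilator. Then \<open>id_blinfun - 2 *\<^sub>R P\<close> is an involution, so its norm
  cannot be less than 1.\<close>

theorem ai_u_ideal_imp_strict_u_ideal:
  fixes X :: "'a::real_normed_vector set"
  assumes "\<exists>y::'a. y \<noteq> 0" and ai: "ai_u_ideal X"
  shows "strict_u_ideal X"
proof -
  obtain P :: "('a \<Rightarrow>\<^sub>L real) \<Rightarrow>\<^sub>L ('a \<Rightarrow>\<^sub>L real)"
    where norm_P: "norm P \<le> 1" and u: "norm (id_blinfun - 2 *\<^sub>R P) \<le> 1"
    and P_X: "\<And>f x. x \<in> X \<Longrightarrow> blinfun_apply (blinfun_apply P f) x = blinfun_apply f x"
    and P_ann: "\<And>f. f \<in> annihilator X \<Longrightarrow> blinfun_apply P f = 0"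
    using u_projection_of_ai_u_ideal[OF ai] by metis
  have "blinfun_apply P (blinfun_apply P f - f) = 0" for f
    by (rule P_ann) (simp add: annihilator_def P_X blinfun.bilinear_simps)
  then have PP: "blinfun_apply P (blinfun_apply P f) = blinfun_apply P f" for f
    by (simp add: blinfun.diff_right)
  have ker: "{f. blinfun_apply P f = 0} = annihilator X"
  proof (intro equalityI subsetI CollectI)
    fix f assume "f \<in> {f. blinfun_apply P f = 0}"
    then have "blinfun_apply f x = 0" if "x \<in> X" for x
      using P_X[OF that, of f] by (simp add: blinfun.zero_left)
    then show "f \<in> annihilator X" by (simp add: annihilator_def)
  qed (rule P_ann)
  let ?U = "id_blinfun - 2 *\<^sub>R P"
  have "1 \<le> norm ?U"
  proof -
    obtain y :: 'a where "y \<noteq> 0" using assms by blast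
    moreover obtain f :: "'a \<Rightarrow>\<^sub>L real" where "blinfun_apply f y = norm y"
      by (rule norming_functional)
    ultimately have "f \<noteq> 0" by (auto simp: blinfun.zero_left)
    have "norm f = norm (blinfun_apply ?U (blinfun_apply ?U f))"
      by (simp add: blinfun.bilinear_simps PP scaleR_2 algebra_simps)
    also have "\<dots> \<le> norm ?U * (norm ?U * norm f)"
      by (intro order_trans[OF norm_blinfun] mult_left_mono norm_blinfun) auto
    also have "\<dots> \<le> norm ?U * (1 * norm f)"
      using u by (intro mult_left_mono mult_right_mono) auto
    finally show ?thesis using \<open>f \<noteq> 0\<close> by simp
  qed
  with u have "norm ?U = 1" by simp
  moreover have "ideal_projection X P"
    unfolding ideal_projection_def using norm_P ker by (auto intro!: blinfun_eqI simp: PP)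
  moreover have "one_norming (range (blinfun_apply P))"
    by (rule range_of_u_projection_norming[OF ai norm_P P_X])
  ultimately show ?thesis by (auto simp: strict_u_ideal_def)
qed

section \<open>Strict u-ideals are almost isometric u-ideals\<close>

lemma ideal_projection_apply:
  assumes P: "ideal_projection X P" and x: "x \<in> X"
  shows "blinfun_apply (blinfun_apply P f) x = blinfun_apply f x"
proof -
  have PP: "P o\<^sub>L P = P" and ker: "{f. blinfun_apply P f = 0} = annihilator X"
    using P by (auto simp: ideal_projection_def)
  have "blinfun_apply P (blinfun_apply P f) = blinfun_apply P f"
    using arg_cong[OF PP, of "\<lambda>Q. blinfun_apply Q f"] by simp
  then have "blinfun_apply P (blinfun_apply P f - f) = 0"
    by (simp add: blinfun.diff_right)
  then have "blinfun_apply P f - f \<in> annihilator X"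
    using ker by blast
  with x show ?thesis
    by (simp add: annihilator_def blinfun.diff_left)
qed

text \<open>The hypothesis \<open>dual\<close> says that the inequalities hold for the bidual-valued map behind
  \<open>P\<close>, that is, with \<open>P (g o\<^sub>L A i)\<close> at \<open>e i\<close> in place of \<open>g (A i (T (e i)))\<close>. By \<open>finite_dim_decomposition\<close> the admissible \<open>T\<close> are \<open>T0 + (\<Sum>d\<in>D. \<phi> d _ *\<^sub>R x d)\<close> with
  arbitrary \<open>x d \<in> X\<close>, so Helly's condition applies. If \<open>g\<close> annihilates all perturbations, then for
  each \<open>d\<close> the functional \<open>\<Sum>i\<in>I. \<phi> d (e i) *\<^sub>R (g i o\<^sub>L A i)\<close> vanishes on \<open>X\<close>, hence is killed by
  \<open>P\<close>. Hence \<open>T0\<close> and the bidual-valued map give the same value in the combination with coefficients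
  \<open>g i\<close>.\<close>

lemma ideal_projection_lifting:
  fixes X :: "'a::real_normed_vector set" and A :: "'i \<Rightarrow> 'a \<Rightarrow>\<^sub>L 'a"
  assumes P: "ideal_projection X P" and X: "subspace X" and B: "finite B"
    and I: "finite I" and e: "\<And>i. e i \<in> span B"
    and r: "\<And>i. 0 \<le> r i" and \<epsilon>: "0 < \<epsilon>"
    and dual: "\<And>i g. i \<in> I \<Longrightarrow>
      blinfun_apply (blinfun_apply P (g o\<^sub>L A i)) (e i) + blinfun_apply g (c i) \<le> r i * norm g"
  obtains T where "linear T" "T ` span B \<subseteq> X" "\<And>x. x \<in> X \<inter> span B \<Longrightarrow> T x = x"
    "\<And>i. i \<in> I \<Longrightarrow> norm (blinfun_apply (A i) (T (e i)) + c i) \<le> r i + \<epsilon>"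
proof -
  obtain T0 D and \<phi> :: "'a \<Rightarrow> 'a \<Rightarrow> real"
    where T0: "linear T0" "T0 ` span B \<subseteq> X" "\<And>x. x \<in> X \<inter> span B \<Longrightarrow> T0 x = x"
      and D: "finite D" and lin: "\<And>d. linear (\<phi> d)"
      and \<phi>_X: "\<And>d x. d \<in> D \<Longrightarrow> x \<in> X \<inter> span B \<Longrightarrow> \<phi> d x = 0"
      and decomp: "\<And>e. e \<in> span B \<Longrightarrow> e = T0 e + (\<Sum>d\<in>D. \<phi> d e *\<^sub>R d)"
    by (rule finite_dim_decomposition[OF X B]) blast
  define R where "R x y = (\<Sum>d\<in>D. \<phi> d y *\<^sub>R x d)" for x :: "'a \<Rightarrow> 'a" and y
  define s where "s x i = blinfun_apply (A i) (R x (e i))" for x i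
  define S where "S = {s x | x. \<forall>d. x d \<in> X}"
  have "pointwise_subspace S"
    unfolding pointwise_subspace_def
  proof (intro conjI ballI allI)
    have "(\<lambda>i. 0) = s (\<lambda>d. 0)"
      by (simp add: s_def R_def blinfun.zero_right fun_eq_iff)
    then show "(\<lambda>i. 0) \<in> S"
      unfolding S_def using X by (auto simp: subspace_0)
  next
    fix u v assume "u \<in> S" "v \<in> S"
    then obtain x y where xy: "u = s x" "v = s y" "\<And>d. x d \<in> X" "\<And>d. y d \<in> X"
      by (auto simp: S_def)
    then have "(\<lambda>i. u i + v i) = s (\<lambda>d. x d + y d)"
      by (simp add: s_def R_def fun_eq_iff scaleR_add_right sum.distrib blinfun.add_right)
    moreover have "x d + y d \<in> X" for d
      using X xy by (intro subspace_add)
    ultimately show "(\<lambda>i. u i + v i) \<in> S"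
      by (auto simp: S_def)
  next
    fix a :: real and u assume "u \<in> S"
    then obtain x where x: "u = s x" "\<And>d. x d \<in> X"
      by (auto simp: S_def)
    then have "(\<lambda>i. a *\<^sub>R u i) = s (\<lambda>d. a *\<^sub>R x d)"
      by (simp add: s_def R_def fun_eq_iff scaleR_sum_right mult.commute flip: blinfun.scaleR_right)
    moreover have "a *\<^sub>R x d \<in> X" for d
      using X x by (intro subspace_scale)
    ultimately show "(\<lambda>i. a *\<^sub>R u i) \<in> S"
      by (auto simp: S_def)
  qed
  then have "\<exists>u\<in>S. \<forall>i\<in>I. norm (blinfun_apply (A i) (T0 (e i)) + c i + u i) \<le> r i + \<epsilon>"
  proof (rule Helly_condition[OF I _ r \<epsilon>])
    fix g :: "'i \<Rightarrow> 'a \<Rightarrow>\<^sub>L real"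
    assume g: "\<And>u. u \<in> S \<Longrightarrow> (\<Sum>i\<in>I. blinfun_apply (g i) (u i)) = 0"
    define h where "h i = g i o\<^sub>L A i" for i
    have h: "blinfun_apply (g i) (blinfun_apply (A i) y) = blinfun_apply (h i) y" for i y
      by (simp add: h_def)
    have "(\<Sum>i\<in>I. \<phi> d (e i) *\<^sub>R h i) \<in> annihilator X" if d: "d \<in> D" for d
      unfolding annihilator_def
    proof (intro CollectI ballI)
      fix x assume x: "x \<in> X"
      let ?x = "\<lambda>d'. if d' = d then x else 0"
      have R: "R ?x y = \<phi> d y *\<^sub>R x" for y
        using d D by (simp add: R_def if_distrib[of "\<lambda>z. _ *\<^sub>R z"] sum.delta' cong: if_cong)
      have "s ?x \<in> S"
        unfolding S_def using x X by (auto simp: subspace_0)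
      from g[OF this] have "0 = (\<Sum>i\<in>I. blinfun_apply (h i) (R ?x (e i)))"
        by (simp add: s_def h)
      then show "blinfun_apply (\<Sum>i\<in>I. \<phi> d (e i) *\<^sub>R h i) x = 0"
        by (simp add: R blinfun.sum_left blinfun.scaleR_left blinfun.scaleR_right)
    qed
    then have ann: "blinfun_apply P (\<Sum>i\<in>I. \<phi> d (e i) *\<^sub>R h i) = 0" if "d \<in> D" for d
      using that P by (auto simp: ideal_projection_def)
    have "(\<Sum>i\<in>I. \<phi> d (e i) * blinfun_apply (blinfun_apply P (h i)) d) = 0" if "d \<in> D" for d
      using arg_cong[OF ann[OF that], of "\<lambda>f. blinfun_apply f d"]
      by (simp add: blinfun.sum_right blinfun.sum_left blinfun.scaleR_left blinfun.scaleR_right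
          blinfun.zero_left)
    then have "0 = (\<Sum>d\<in>D. \<Sum>i\<in>I. \<phi> d (e i) * blinfun_apply (blinfun_apply P (h i)) d)"
      by simp
    also have "\<dots> = (\<Sum>i\<in>I. \<Sum>d\<in>D. \<phi> d (e i) * blinfun_apply (blinfun_apply P (h i)) d)"
      by (rule sum.swap)
    also have "\<dots> = (\<Sum>i\<in>I. blinfun_apply (blinfun_apply P (h i)) (e i) - blinfun_apply (h i) (T0 (e i)))"
    proof (rule sum.cong[OF refl])
      fix i
      have "blinfun_apply (blinfun_apply P (h i)) (e i) =
          blinfun_apply (blinfun_apply P (h i)) (T0 (e i) + (\<Sum>d\<in>D. \<phi> d (e i) *\<^sub>R d))"
        using decomp[OF e[of i]] by simp
      moreover have "blinfun_apply (blinfun_apply P (h i)) (T0 (e i)) = blinfun_apply (h i) (T0 (e i))"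
        using T0(2) e[of i] by (intro ideal_projection_apply[OF P]) auto
      ultimately show "(\<Sum>d\<in>D. \<phi> d (e i) * blinfun_apply (blinfun_apply P (h i)) d) =
          blinfun_apply (blinfun_apply P (h i)) (e i) - blinfun_apply (h i) (T0 (e i))"
        by (simp add: blinfun.add_right blinfun.sum_right blinfun.scaleR_right)
    qed
    finally have "(\<Sum>i\<in>I. blinfun_apply (h i) (T0 (e i))) =
        (\<Sum>i\<in>I. blinfun_apply (blinfun_apply P (h i)) (e i))"
      by (simp add: sum_subtractf)
    then have "(\<Sum>i\<in>I. blinfun_apply (g i) (blinfun_apply (A i) (T0 (e i)) + c i)) =
        (\<Sum>i\<in>I. blinfun_apply (blinfun_apply P (h i)) (e i) + blinfun_apply (g i) (c i))"
      by (simp add: blinfun.add_right h sum.distrib)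
    also have "\<dots> \<le> (\<Sum>i\<in>I. r i * norm (g i))"
      using dual by (intro sum_mono) (simp add: h_def)
    finally show "(\<Sum>i\<in>I. blinfun_apply (g i) (blinfun_apply (A i) (T0 (e i)) + c i))
        \<le> (\<Sum>i\<in>I. r i * norm (g i))" .
  qed
  then obtain x where x: "\<And>d. x d \<in> X"
    and le: "\<And>i. i \<in> I \<Longrightarrow> norm (blinfun_apply (A i) (T0 (e i)) + c i + s x i) \<le> r i + \<epsilon>"
    by (auto simp: S_def)
  show ?thesis
  proof (rule that[of "\<lambda>y. T0 y + R x y"])
    show "linear (\<lambda>y. T0 y + R x y)"
      unfolding R_def
      by (intro linear_compose_add[OF T0(1)] linear_compose_sum ballI)
        (auto intro!: linearI simp: linear_add[OF lin] linear_scale[OF lin] scaleR_add_left)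
    have "R x y \<in> X" for y
      unfolding R_def using X x by (intro subspace_sum subspace_scale)
    then show "(\<lambda>y. T0 y + R x y) ` span B \<subseteq> X"
      using T0(2) X by (auto intro!: subspace_add)
    show "T0 y + R x y = y" if "y \<in> X \<inter> span B" for y
      using that \<phi>_X T0(3) by (simp add: R_def)
    show "norm (blinfun_apply (A i) (T0 (e i) + R x (e i)) + c i) \<le> r i + \<epsilon>" if "i \<in> I" for i
      using le[OF that] by (simp add: s_def blinfun.add_right algebra_simps)
  qed
qed

text \<open>Three constraints are imposed at each net point \<open>n\<close>, indexed by \<open>(n, k)\<close>. For \<open>k = 0\<close> and
  \<open>k = 1\<close> they bound \<open>T n\<close> and \<open>n - 2 *\<^sub>R T n\<close>; their dual versions are \<open>norm P \<le> 1\<close> and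
  \<open>norm (id_blinfun - 2 *\<^sub>R P) = 1\<close>. For \<open>k = 2\<close> the constraint is \<open>f n (T n) \<approx> f n n\<close>, where \<open>f n\<close>
  in the range of \<open>P\<close> almost norms \<open>n\<close>; its dual version is \<open>P (f n) = f n\<close>, and it provides the
  lower bound on \<open>norm (T n)\<close>.\<close>

lemma almost_isometry_on_net:
  fixes X :: "'a::real_normed_vector set"
  assumes y: "\<exists>y::'a. y \<noteq> 0" and X: "subspace X" and strict: "strict_u_ideal X"
    and B: "finite B" and N: "finite N" "N \<subseteq> span B" and \<delta>: "0 < \<delta>"
  obtains T where "linear T" "T ` span B \<subseteq> X" "\<And>x. x \<in> X \<inter> span B \<Longrightarrow> T x = x"
    "\<And>n. n \<in> N \<Longrightarrow> norm (T n) \<le> norm n + \<delta>"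
    "\<And>n. n \<in> N \<Longrightarrow> norm (n - 2 *\<^sub>R T n) \<le> norm n + \<delta>"
    "\<And>n. n \<in> N \<Longrightarrow> norm n - 2 * \<delta> \<le> norm (T n)"
proof -
  obtain P where P: "ideal_projection X P" and u: "norm (id_blinfun - 2 *\<^sub>R P) = 1"
    and norming: "one_norming (range (blinfun_apply P))"
    using strict by (auto simp: strict_u_ideal_def)
  have norm_P: "norm P \<le> 1" and PP: "P o\<^sub>L P = P"
    using P by (auto simp: ideal_projection_def)
  obtain y0 :: 'a where y0: "norm y0 = 1"
    using y by (metis norm_sgn)
  have "\<exists>f. f \<in> range (blinfun_apply P) \<and> norm f \<le> 1 \<and> norm n - \<delta> \<le> \<bar>blinfun_apply f n\<bar>" for n
  proof -
    let ?S = "{\<bar>blinfun_apply f n\<bar> | f. f \<in> range (blinfun_apply P) \<and> norm f \<le> 1}"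
    have "?S \<noteq> {}"
      by (auto intro!: exI[of _ "blinfun_apply P 0"] simp: blinfun.zero_right)
    moreover have "norm n - \<delta> < Sup ?S"
      using norming \<delta> by (simp add: one_norming_def)
    ultimately have "\<exists>t\<in>?S. norm n - \<delta> < t"
      by (rule less_cSupD)
    then show ?thesis by force
  qed
  then obtain f where f: "\<And>n. f n \<in> range (blinfun_apply P)" "\<And>n. norm (f n) \<le> 1"
    "\<And>n. norm n - \<delta> \<le> \<bar>blinfun_apply (f n) n\<bar>"
    by metis
  have Pf: "blinfun_apply P (f n) = f n" for n
    using f(1)[of n] arg_cong[OF PP, of "\<lambda>Q. blinfun_apply Q _"] by auto
  \<comment> \<open>the scalar constraint for \<open>k = 2\<close> is turned into a vector one along the unit vector \<open>y0\<close>\<close>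
  define A :: "'a \<times> nat \<Rightarrow> 'a \<Rightarrow>\<^sub>L 'a" where "A = (\<lambda>(n, k).
    if k = 0 then id_blinfun else if k = 1 then - 2 *\<^sub>R id_blinfun
    else blinfun_scaleR_left y0 o\<^sub>L f n)"
  define c :: "'a \<times> nat \<Rightarrow> 'a" where "c = (\<lambda>(n, k).
    if k = 0 then 0 else if k = 1 then n else - (blinfun_apply (f n) n *\<^sub>R y0))"
  define r :: "'a \<times> nat \<Rightarrow> real" where "r = (\<lambda>(n, k). if k \<le> 1 then norm n else 0)"
  \<comment> \<open>the value 0 outside the net only serves to keep \<open>e i\<close> in \<open>span B\<close> for every index\<close>
  define e :: "'a \<times> nat \<Rightarrow> 'a" where "e = (\<lambda>(n, k). if n \<in> N then n else 0)"
  let ?I = "N \<times> {..2::nat}"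
  obtain T where T: "linear T" "T ` span B \<subseteq> X" "\<And>x. x \<in> X \<inter> span B \<Longrightarrow> T x = x"
    and le: "\<And>i. i \<in> ?I \<Longrightarrow> norm (blinfun_apply (A i) (T (e i)) + c i) \<le> r i + \<delta>"
  proof (rule ideal_projection_lifting[OF P X B, of ?I e r \<delta> A c])
    show "finite ?I" using N(1) by simp
    show "e i \<in> span B" for i
      using N(2) by (auto simp: e_def span_zero split: prod.split)
    show "0 \<le> r i" for i by (auto simp: r_def split: prod.split)
    show "blinfun_apply (blinfun_apply P (g o\<^sub>L A i)) (e i) + blinfun_apply g (c i) \<le> r i * norm g"
      if "i \<in> ?I" for i and g :: "'a \<Rightarrow>\<^sub>L real"
    proof -
      obtain n k where i: "i = (n, k)" and n: "n \<in> N" using \<open>i \<in> ?I\<close> by blast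
      consider "k = 0" | "k = 1" | "k \<noteq> 0" "k \<noteq> 1" by blast
      then show ?thesis
      proof cases
        case 1
        then have A: "g o\<^sub>L A i = g" by (intro blinfun_eqI) (simp add: A_def i)
        have "norm (blinfun_apply P g) \<le> 1 * norm g"
          using norm_P by (intro order_trans[OF norm_blinfun] mult_right_mono) auto
        then have "norm (blinfun_apply P g) * norm n \<le> norm g * norm n"
          by (intro mult_right_mono) auto
        then have "blinfun_apply (blinfun_apply P g) n \<le> norm g * norm n"
          using norm_blinfun[of "blinfun_apply P g" n] by simp
        with 1 n A show ?thesis
          by (simp add: i c_def r_def e_def blinfun.zero_right mult.commute)
      next
        case 2
        then have A: "g o\<^sub>L A i = - 2 *\<^sub>R g"
          by (intro blinfun_eqI) (simp add: A_def i blinfun.bilinear_simps)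
        let ?Ug = "blinfun_apply (id_blinfun - 2 *\<^sub>R P) g"
        have "norm ?Ug \<le> 1 * norm g"
          using u by (metis norm_blinfun)
        then have "norm ?Ug * norm n \<le> norm g * norm n"
          by (intro mult_right_mono) auto
        then have "blinfun_apply ?Ug n \<le> norm g * norm n"
          using norm_blinfun[of ?Ug n] by simp
        with 2 n show ?thesis
          unfolding A by (simp add: i c_def r_def e_def blinfun.bilinear_simps mult.commute)
      next
        case 3
        then have A: "g o\<^sub>L A i = blinfun_apply g y0 *\<^sub>R f n"
          by (intro blinfun_eqI) (simp add: A_def i blinfun.bilinear_simps mult.commute)
        from 3 n show ?thesis
          unfolding A by (simp add: i c_def r_def e_def Pf blinfun.bilinear_simps mult.commute)
      qed
    qed
  qed (use \<delta> in simp_all)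
  show ?thesis
  proof (rule that[OF T])
    fix n assume n: "n \<in> N"
    show "norm (T n) \<le> norm n + \<delta>"
      using le[of "(n, 0)"] n by (simp add: A_def c_def r_def e_def)
    show "norm (n - 2 *\<^sub>R T n) \<le> norm n + \<delta>"
      using le[of "(n, 1)"] n by (simp add: A_def c_def r_def e_def blinfun.bilinear_simps)
    have "norm (blinfun_apply (f n) (T n) *\<^sub>R y0 - blinfun_apply (f n) n *\<^sub>R y0) \<le> \<delta>"
      using le[of "(n, 2)"] n by (simp add: A_def c_def r_def e_def)
    then have "\<bar>blinfun_apply (f n) (T n) - blinfun_apply (f n) n\<bar> \<le> \<delta>"
      by (simp add: y0 flip: scaleR_diff_left)
    moreover have "\<bar>blinfun_apply (f n) (T n)\<bar> \<le> 1 * norm (T n)"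
      using norm_blinfun[of "f n" "T n"] mult_right_mono[OF f(2)[of n] norm_ge_zero[of "T n"]] by simp
    ultimately show "norm n - 2 * \<delta> \<le> norm (T n)"
      using f(3)[of n] by linarith
  qed
qed

text \<open>Let \<open>M\<close> be the norm of \<open>T\<close> on \<open>span B\<close>, which is finite. Comparing with a net point gives
  \<open>M \<le> 1 + \<delta> + M * \<delta>\<close>, so \<open>M \<le> 2\<close>; after that, replacing a vector of the unit ball by a net point
  changes each of the three quantities by a multiple of \<open>\<delta>\<close>.\<close>

lemma almost_isometry_from_net:
  fixes T :: "'a::real_normed_vector \<Rightarrow> 'a"
  assumes T: "linear T" and B: "finite B" and \<delta>: "0 < \<delta>" "\<delta> \<le> 1 / 8"
    and N: "N \<subseteq> span B \<inter> cball 0 1"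
    and net: "\<And>e. e \<in> span B \<Longrightarrow> norm e \<le> 1 \<Longrightarrow> \<exists>n\<in>N. norm (e - n) \<le> \<delta>"
    and le: "\<And>n. n \<in> N \<Longrightarrow> norm (T n) \<le> norm n + \<delta>"
    and u: "\<And>n. n \<in> N \<Longrightarrow> norm (n - 2 *\<^sub>R T n) \<le> norm n + \<delta>"
    and ge: "\<And>n. n \<in> N \<Longrightarrow> norm n - 2 * \<delta> \<le> norm (T n)"
    and e: "e \<in> span B"
  shows "norm (T e) \<le> (1 + 8 * \<delta>) * norm e"
    and "norm (e - 2 *\<^sub>R T e) \<le> (1 + 8 * \<delta>) * norm e"
    and "(1 - 8 * \<delta>) * norm e \<le> norm (T e)"
proof -
  note T_diff = linear_diff[OF T] and T_scale = linear_scale[OF T]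
  obtain K where K: "0 \<le> K" "\<And>e. e \<in> span B \<Longrightarrow> norm (T e) \<le> K * norm e"
    using linear_bounded_on_finite_span[OF B T] by blast
  define M where "M = Sup ((\<lambda>e. norm (T e)) ` (span B \<inter> cball 0 1))"
  have T_M: "norm (T e) \<le> M" if "e \<in> span B" "norm e \<le> 1" for e
    unfolding M_def
  proof (rule cSup_upper)
    have "norm (T e) \<le> K" if "e \<in> span B" "norm e \<le> 1" for e
      using K(2)[OF that(1)] mult_left_mono[OF that(2) K(1)] by simp
    then show "bdd_above ((\<lambda>e. norm (T e)) ` (span B \<inter> cball 0 1))"
      by (intro bdd_aboveI2[of _ _ K]) auto
  qed (use that in auto)
  have homog: "norm (F e) \<le> M' * norm e"
    if F: "\<And>c e. F (c *\<^sub>R e) = c *\<^sub>R F e" and M': "\<And>e. e \<in> span B \<Longrightarrow> norm e \<le> 1 \<Longrightarrow> norm (F e) \<le> M'"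
      and e: "e \<in> span B" for F :: "'a \<Rightarrow> 'a" and M' e
  proof (cases "e = 0")
    case True
    then show ?thesis using F[of 0 0] by simp
  next
    case False
    have "norm (F (inverse (norm e) *\<^sub>R e)) \<le> M'"
      using e False by (intro M') (auto intro: span_scale)
    then show ?thesis using False by (simp add: F field_simps)
  qed
  have diff: "norm (T (e - n)) \<le> M * \<delta>" if "e \<in> span B" "n \<in> span B" "norm (e - n) \<le> \<delta>" for e n
  proof -
    have "norm (T (e - n)) \<le> M * norm (e - n)"
      using that by (intro homog T_scale T_M) (auto intro: span_diff)
    also have "\<dots> \<le> M * \<delta>"
      using that(3) T_M[of 0] by (intro mult_left_mono) (auto simp: span_zero intro: order_trans[OF norm_ge_zero])
    finally show ?thesis .
  qed
  \<comment> \<open>absorbed below into the left-hand side, which is possible because \<open>M\<close> is finite\<close>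
  have "M \<le> 1 + \<delta> + M * \<delta>"
    unfolding M_def
  proof (rule cSup_least)
    show "(\<lambda>e. norm (T e)) ` (span B \<inter> cball 0 1) \<noteq> {}"
      using span_zero[of B] by auto
    fix t assume "t \<in> (\<lambda>e. norm (T e)) ` (span B \<inter> cball 0 1)"
    then obtain e where e: "t = norm (T e)" "e \<in> span B" "norm e \<le> 1" by auto
    then obtain n where n: "n \<in> N" "norm (e - n) \<le> \<delta>" using net by blast
    have "norm (T e) \<le> norm (T n) + norm (T (e - n))"
      using norm_triangle_ineq[of "T n" "T (e - n)"] by (simp add: T_diff)
    then show "t \<le> 1 + \<delta> + Sup ((\<lambda>e. norm (T e)) ` (span B \<inter> cball 0 1)) * \<delta>"
      using le[OF n(1)] diff[of e n] n e N unfolding M_def by force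
  qed
  also have "M * \<delta> \<le> M * (1 / 8)"
    using \<delta> T_M[of 0] by (intro mult_left_mono) (auto simp: span_zero intro: order_trans[OF norm_ge_zero])
  finally have "M \<le> 2" using \<delta>(2) by simp
  then have M\<delta>: "M * \<delta> \<le> 2 * \<delta>" using \<delta>(1) by simp
  have T_1: "norm (T e) \<le> 1 + 8 * \<delta>" if "e \<in> span B" "norm e \<le> 1" for e
    using T_M[OF that] \<open>M \<le> 1 + \<delta> + M * \<delta>\<close> M\<delta> \<delta>(1) by linarith
  show "norm (T e) \<le> (1 + 8 * \<delta>) * norm e"
    using e by (intro homog T_scale T_1)
  have u_1: "norm (e - 2 *\<^sub>R T e) \<le> 1 + 8 * \<delta>" if e: "e \<in> span B" "norm e \<le> 1" for e
  proof -
    obtain n where n: "n \<in> N" "norm (e - n) \<le> \<delta>" using net[OF e] by blast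
    with N have nB: "n \<in> span B" "norm n \<le> 1" by auto
    have "e - 2 *\<^sub>R T e = (n - 2 *\<^sub>R T n) + ((e - n) - 2 *\<^sub>R T (e - n))"
      by (simp add: T_diff algebra_simps)
    also have "norm \<dots> \<le> norm (n - 2 *\<^sub>R T n) + (norm (e - n) + norm (2 *\<^sub>R T (e - n)))"
      by (intro order_trans[OF norm_triangle_ineq] add_left_mono norm_triangle_ineq4)
    also have "\<dots> = norm (n - 2 *\<^sub>R T n) + (norm (e - n) + 2 * norm (T (e - n)))"
      by simp
    finally show ?thesis
      using u[OF n(1)] diff[OF e(1) nB(1) n(2)] n(2) nB(2) M\<delta> \<delta>(1) by linarith
  qed
  show "norm (e - 2 *\<^sub>R T e) \<le> (1 + 8 * \<delta>) * norm e"
    using e by (intro homog[of "\<lambda>e. e - 2 *\<^sub>R T e"] u_1) (simp_all add: T_scale scaleR_diff_right)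
  show "(1 - 8 * \<delta>) * norm e \<le> norm (T e)"
  proof (cases "e = 0")
    case False
    define e1 where "e1 = inverse (norm e) *\<^sub>R e"
    have e1: "e1 \<in> span B" "norm e1 = 1"
      using e False by (auto simp: e1_def intro: span_scale)
    then obtain n where n: "n \<in> N" "norm (e1 - n) \<le> \<delta>" using net[of e1] by auto
    with N have nB: "n \<in> span B" by auto
    have "norm (T n) \<le> norm (T e1) + norm (T (e1 - n))"
      using norm_triangle_ineq4[of "T e1" "T (e1 - n)"] by (simp add: T_diff)
    moreover have "1 - \<delta> \<le> norm n"
      using norm_triangle_ineq2[of e1 n] n(2) e1(2) by linarith
    ultimately have "1 - 8 * \<delta> \<le> norm (T e1)"
      using ge[OF n(1)] diff[OF e1(1) nB n(2)] M\<delta> \<delta>(1) by linarith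
    then show ?thesis
      using False by (simp add: e1_def T_scale field_simps)
  qed (use linear_0[OF T] in simp)
qed

theorem strict_u_ideal_imp_ai_u_ideal:
  fixes X :: "'a::real_normed_vector set"
  assumes "\<exists>y::'a. y \<noteq> 0" "subspace X" "strict_u_ideal X"
  shows "ai_u_ideal X"
  unfolding ai_u_ideal_def
proof (intro allI impI)
  fix \<epsilon> :: real and E :: "'a set"
  assume \<epsilon>: "0 < \<epsilon>" and "finite_dim_subspace E"
  then obtain B where B: "finite B" "E = span B" by (auto simp: finite_dim_subspace_def)
  \<comment> \<open>chosen so that \<open>1 - 8 * \<delta>\<close> is exactly \<open>inverse (1 + \<epsilon>)\<close>\<close>
  define \<delta> where "\<delta> = \<epsilon> / (8 * (1 + \<epsilon>))"
  have \<delta>: "0 < \<delta>" "\<delta> \<le> 1 / 8" using \<epsilon> by (auto simp: \<delta>_def field_simps)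
  have up: "1 + 8 * \<delta> \<le> 1 + \<epsilon>" using \<epsilon> by (simp add: \<delta>_def field_simps)
  have low: "1 - 8 * \<delta> = inverse (1 + \<epsilon>)" using \<epsilon> by (simp add: \<delta>_def field_simps)
  obtain N where N: "finite N" "N \<subseteq> span B \<inter> cball 0 1"
    "\<And>e. e \<in> span B \<Longrightarrow> norm e \<le> 1 \<Longrightarrow> \<exists>n\<in>N. norm (e - n) \<le> \<delta>"
    using finite_net_of_ball[OF B(1) \<delta>(1)] by metis
  then have "N \<subseteq> span B" by blast
  then obtain T where T: "linear T" "T ` span B \<subseteq> X" "\<And>x. x \<in> X \<inter> span B \<Longrightarrow> T x = x"
    "\<And>n. n \<in> N \<Longrightarrow> norm (T n) \<le> norm n + \<delta>"
    "\<And>n. n \<in> N \<Longrightarrow> norm (n - 2 *\<^sub>R T n) \<le> norm n + \<delta>"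
    "\<And>n. n \<in> N \<Longrightarrow> norm n - 2 * \<delta> \<le> norm (T n)"
    using almost_isometry_on_net[OF assms B(1) N(1) _ \<delta>(1)] by metis
  note bounds = almost_isometry_from_net[OF T(1) B(1) \<delta> N(2,3) T(4-6)]
  have up_e: "(1 + 8 * \<delta>) * norm e \<le> (1 + \<epsilon>) * norm e" for e :: 'a
    using up by (intro mult_right_mono) auto
  have "linear_operator_between E X T"
    using T(1,2) B(2) by (auto simp: linear_operator_between_def linear_add linear_scale)
  moreover have "\<forall>e\<in>X \<inter> E. T e = e" using T(3) B(2) by blast
  moreover have "inverse (1 + \<epsilon>) * norm e \<le> norm (T e)" "norm (T e) \<le> (1 + \<epsilon>) * norm e"
    "norm (e - 2 *\<^sub>R T e) \<le> (1 + \<epsilon>) * norm e" if "e \<in> E" for e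
    using bounds[of e] that up_e[of e] by (auto simp: B(2) low)
  ultimately show "\<exists>T. linear_operator_between E X T \<and> (\<forall>e\<in>X \<inter> E. T e = e) \<and>
      (\<forall>e\<in>E. inverse (1 + \<epsilon>) * norm e \<le> norm (T e) \<and> norm (T e) \<le> (1 + \<epsilon>) * norm e) \<and>
      (\<forall>e\<in>E. norm (e - 2 *\<^sub>R T e) \<le> (1 + \<epsilon>) * norm e)"
    by blast
qed

section \<open>The equivalence\<close>

theorem theorem2p3:
  fixes X :: "'a::banach set"
  assumes "\<exists>y::'a. y \<noteq> 0"
    and "subspace X"
  shows "ai_u_ideal X \<longleftrightarrow> strict_u_ideal X"
  using ai_u_ideal_imp_strict_u_ideal strict_u_ideal_imp_ai_u_ideal assms by blast

end
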